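(* Let $\mathcal{S}$ be a separable metric space, $\mu$ a Borel probability measure on $\mathcal{S}$, and $\kappa:\mathcal{S}\times\mathcal{S}\to[0,\infty)$ a symmetric kernel with $\kappa\in L^2(\mathcal{S}\times\mathcal{S},\mu\otimes\mu)$. Suppose that $\kappa$ is homogeneous, i.e. there is a group $\Gamma$ acting transitively on $\mathcal{S}$ such that $\mu$ is invariant under the action of $\Gamma$ and $\kappa(gx,gy)=\kappa(x,y)$ for all $g\in\Gamma$ and $x,y\in\mathcal{S}$. Suppose further that $\kappa$ is irreducible and continuous at $(\mu\otimes\mu)$-almost every point of $\mathcal{S}\times\mathcal{S}$. Then \[ \lim_{n\to\infty}\mathbb{P}\bigl(G(n,\kappa)\text{ is connected}\bigr)=\begin{cases}0&\text{if }\lambda_*<1,\\ 1&\text{if }\lambda_*>1.\end{cases} \]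
   Context: Let $X_1,\dots,X_n$ be independent $\mu$-distributed random points of $\mathcal{S}$ and $p_n=\log n/n$. The random graph $G(n,\kappa)=(V_n,E_n)$ has vertex set $V_n=\{1,\dots,n\}$; given $X_1,\dots,X_n$, each pair $i\ne j$ is joined by an edge independently with probability $p_{ij}=\min\{1,\kappa(X_i,X_j)p_n\}$. $\lambda(x)=\int_{\mathcal{S}}\kappa(x,y)\,d\mu(y)$ and $\lambda_*=\operatorname{ess\,inf}_{x}\lambda(x)$ (essential infimum with respect to $\mu$). The group acts by measurable maps, and invariance of $\mu$ means that each map $x\mapsto gx$ preserves $\mu$. The kernel $\kappa$ is reducible if there is a measurable set $\mathcal{A}\subset\mathcal{S}$ with $0<\mu(\mathcal{A})<1$ such that $\kappa=0$ $(\mu\otimes\mu)$-almost everywhere on $\mathcal{A}\times\mathcal{A}^c$; otherwise $\kappa$ is irreducible. *)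

theory Defs
  imports
    "HOL-Probability.Probability"
    "HOL-Algebra.Group_Action"
    "Graph_Theory.Digraph_Component"
begin

hide_const (open) Digraph_Component.connected

text \<open>Written like the library's \<^const>\<open>esssup\<close>, with \<^const>\<open>Liminf\<close> for \<^const>\<open>Limsup\<close>.\<close>

definition essinf ::
  "'a measure \<Rightarrow> ('a \<Rightarrow> 'b :: {second_countable_topology, dense_linorder, linorder_topology, complete_linorder}) \<Rightarrow> 'b"
  where "essinf M f = (if f \<in> borel_measurable M then Liminf (ae_filter M) f else bot)"

lemma essinf_eq_AE:
  assumes "f \<in> borel_measurable M"
  shows "essinf M f = Sup {z. AE x in M. z \<le> f x}"
  unfolding essinf_def if_P[OF assms] Liminf_def
proof (intro antisym SUP_least Sup_least; clarsimp)
  fix z assume "AE x in M. z \<le> f x"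
  then have "(\<lambda>x. z \<le> f x) \<in> {P. AE x in M. P x}"
    by simp
  then show "z \<le> (SUP P\<in>{P. AE x in M. P x}. INF x\<in>Collect P. f x)"
    by (rule SUP_upper2) (auto intro: INF_greatest)
next
  fix P assume P: "AE x in M. P x"
  show "(INF x\<in>Collect P. f x) \<le> Sup {z. AE x in M. z \<le> f x}"
    by (rule Sup_upper) (use P in \<open>auto elim!: eventually_mono intro: INF_lower\<close>)
qed

definition kernel_degree :: "'a measure \<Rightarrow> ('a \<Rightarrow> 'a \<Rightarrow> real) \<Rightarrow> 'a \<Rightarrow> ennreal" where
  "kernel_degree M \<kappa> x = (\<integral>\<^sup>+ y. ennreal (\<kappa> x y) \<partial>M)"

definition reducible_kernel :: "'a measure \<Rightarrow> ('a \<Rightarrow> 'a \<Rightarrow> real) \<Rightarrow> bool" where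
  "reducible_kernel M \<kappa> \<longleftrightarrow>
     (\<exists>A\<in>sets M. 0 < measure M A \<and> measure M A < 1 \<and>
        (AE (x, y) in M \<Otimes>\<^sub>M M. (x, y) \<in> A \<times> (space M - A) \<longrightarrow> \<kappa> x y = 0))"

definition edge_prob :: "('a \<Rightarrow> 'a \<Rightarrow> real) \<Rightarrow> nat \<Rightarrow> (nat \<Rightarrow> 'a) \<Rightarrow> nat \<times> nat \<Rightarrow> real" where
  "edge_prob \<kappa> n x = (\<lambda>(i, j). min 1 (\<kappa> (x i) (x j) * (ln (real n) / real n)))"

definition vertex_pairs :: "nat \<Rightarrow> (nat \<times> nat) set" where
  "vertex_pairs n = {(i, j). i \<in> {1..n} \<and> j \<in> {1..n} \<and> i < j}"

text \<open>The graph on \<open>{1..n}\<close> whose edges are the pairs selected by \<open>e\<close>; as an undirected graph it is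
  a symmetric digraph.\<close>

definition graph_of :: "nat \<Rightarrow> (nat \<times> nat \<Rightarrow> bool) \<Rightarrow> nat pair_pre_digraph" where
  "graph_of n e = \<lparr> pverts = {1..n},
     parcs = {(i, j). (i, j) \<in> vertex_pairs n \<and> e (i, j) \<or> (j, i) \<in> vertex_pairs n \<and> e (j, i)} \<rparr>"

lemma pair_graph_graph_of: "pair_graph (graph_of n e)"
proof
  have "parcs (graph_of n e) \<subseteq> {1..n} \<times> {1..n}"
    by (auto simp: graph_of_def vertex_pairs_def)
  then show "finite (parcs (graph_of n e))"
    by (rule finite_subset) simp
  show "symmetric (with_proj (graph_of n e))"
    by (auto simp: symmetric_def graph_of_def intro!: symI)
qed (auto simp: graph_of_def vertex_pairs_def)

text \<open>Conditional law of the graph given the positions \<open>x\<close> of the vertices.\<close>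

definition cond_graph_pmf ::
  "('a \<Rightarrow> 'a \<Rightarrow> real) \<Rightarrow> nat \<Rightarrow> (nat \<Rightarrow> 'a) \<Rightarrow> nat pair_pre_digraph pmf" where
  "cond_graph_pmf \<kappa> n x =
     map_pmf (graph_of n)
       (Pi_pmf (vertex_pairs n) False (\<lambda>ij. bernoulli_pmf (edge_prob \<kappa> n x ij)))"

text \<open>Law of \<open>G(n, \<kappa>)\<close>: draw independent \<open>M\<close>-distributed positions \<open>X\<^sub>1, \<dots>, X\<^sub>n\<close>, then the edges.\<close>

definition random_graph ::
  "'a measure \<Rightarrow> ('a \<Rightarrow> 'a \<Rightarrow> real) \<Rightarrow> nat \<Rightarrow> nat pair_pre_digraph measure" where
  "random_graph M \<kappa> n =
     (\<Pi>\<^sub>M i\<in>{1..n}. M) \<bind> (\<lambda>x. measure_pmf (cond_graph_pmf \<kappa> n x))"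

lemma finite_vertex_pairs [simp]: "finite (vertex_pairs n)"
  by (rule finite_subset[of _ "{1..n} \<times> {1..n}"]) (auto simp: vertex_pairs_def)

lemma measurable_cond_graph_pmf:
  fixes \<kappa> :: "'a \<Rightarrow> 'a \<Rightarrow> real"
  assumes \<kappa>: "(\<lambda>(x, y). \<kappa> x y) \<in> borel_measurable (M \<Otimes>\<^sub>M M)"
    and nonneg: "\<And>x y. 0 \<le> \<kappa> x y"
  shows "(\<lambda>x. measure_pmf (cond_graph_pmf \<kappa> n x))
    \<in> (\<Pi>\<^sub>M i\<in>{1..n}. M) \<rightarrow>\<^sub>M subprob_algebra (count_space UNIV)"
proof (rule measurable_subprob_algebra)
  let ?P = "\<Pi>\<^sub>M i\<in>{1..n}. M"
  let ?S = "PiE_dflt (vertex_pairs n) False (\<lambda>_. UNIV :: bool set)"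
  let ?Q = "\<lambda>x. Pi_pmf (vertex_pairs n) False (\<lambda>ij. bernoulli_pmf (edge_prob \<kappa> n x ij))"
  show "subprob_space (measure_pmf (cond_graph_pmf \<kappa> n x))" for x
    by (rule prob_space_imp_subprob_space) (rule prob_space_measure_pmf)
  fix B :: "nat pair_pre_digraph set"
  let ?T = "?S \<inter> graph_of n -` B"
  have fin: "finite ?T"
    by (intro finite_Int disjI1 finite_PiE_dflt) auto
  have "emeasure (measure_pmf (cond_graph_pmf \<kappa> n x)) B = ennreal (\<Sum>e\<in>?T. pmf (?Q x) e)" for x
  proof -
    have "set_pmf (?Q x) \<subseteq> ?S"
      by (rule order.trans[OF set_Pi_pmf_subset'[OF finite_vertex_pairs]]) (auto simp: PiE_dflt_def)
    then have "measure (?Q x) (graph_of n -` B) = measure (?Q x) ?T"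
      by (intro measure_pmf.finite_measure_eq_AE) (auto simp: AE_measure_pmf_iff)
    also have "\<dots> = (\<Sum>e\<in>?T. pmf (?Q x) e)"
      using fin by (rule measure_measure_pmf_finite)
    finally show ?thesis
      by (simp add: cond_graph_pmf_def measure_pmf.emeasure_eq_measure)
  qed
  moreover have "(\<lambda>x. pmf (?Q x) e) \<in> borel_measurable ?P" if "e \<in> ?T" for e
  proof -
    have le: "0 \<le> edge_prob \<kappa> n x ij" "edge_prob \<kappa> n x ij \<le> 1" for x ij
      using nonneg by (auto simp: edge_prob_def split: prod.split intro!: mult_nonneg_nonneg divide_nonneg_nonneg)
        (cases n; simp)
    have meas: "(\<lambda>x. edge_prob \<kappa> n x ij) \<in> borel_measurable ?P" if ij_in: "ij \<in> vertex_pairs n" for ij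
    proof -
      obtain i j where ij: "ij = (i, j)" "i \<in> {1..n}" "j \<in> {1..n}"
        using ij_in by (auto simp: vertex_pairs_def)
      have "(\<lambda>x. (x i, x j)) \<in> ?P \<rightarrow>\<^sub>M M \<Otimes>\<^sub>M M"
        using ij by (intro measurable_Pair measurable_component_singleton)
      from measurable_compose[OF this \<kappa>] show ?thesis
        by (simp add: edge_prob_def ij)
    qed
    have "pmf (?Q x) e = (\<Prod>ij\<in>vertex_pairs n.
        if e ij then edge_prob \<kappa> n x ij else 1 - edge_prob \<kappa> n x ij)" for x
      using that le by (subst pmf_Pi') (auto simp: PiE_dflt_def intro!: prod.cong)
    then show ?thesis
      by (simp only:) (intro borel_measurable_prod; use meas in \<open>simp del: One_nat_def\<close>)
  qed
  ultimately show "(\<lambda>x. emeasure (measure_pmf (cond_graph_pmf \<kappa> n x)) B) \<in> borel_measurable ?P"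
    by simp
qed simp

lemma prob_space_random_graph:
  fixes \<kappa> :: "'a \<Rightarrow> 'a \<Rightarrow> real"
  assumes "prob_space M"
    and "(\<lambda>(x, y). \<kappa> x y) \<in> borel_measurable (M \<Otimes>\<^sub>M M)"
    and "\<And>x y. 0 \<le> \<kappa> x y"
  shows "prob_space (random_graph M \<kappa> n)"
proof -
  interpret P: prob_space "\<Pi>\<^sub>M i\<in>{1..n}. M"
    by (rule prob_space_PiM) (rule assms(1))
  show ?thesis
    unfolding random_graph_def
    by (rule P.prob_space_bind[OF _ measurable_cond_graph_pmf[OF assms(2,3)]])
      (simp add: prob_space_measure_pmf)
qed

end

theory Submission
  imports Defs "HOL-Real_Asymp.Real_Asymp"
begin

text \<open>Homogeneity enters only through the fact that the law of \<open>\<kappa> x\<close> under \<open>M\<close> is the same for every \<open>x\<close>;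
  in particular \<open>\<lambda>\<close> is a constant. Let \<open>p = ln n / n\<close>.

  If \<open>\<lambda> < 1\<close>, the second moment method produces an isolated vertex: a vertex is isolated with probability at
  least \<open>(1 - p \<lambda>)\<^bsup>n - 1\<^esup>\<close>, and isolation of two vertices is asymptotically independent because \<open>\<kappa>\<close> is
  square integrable.

  If \<open>\<lambda> > 1\<close>, a union bound over vertex sets \<open>S\<close> shows that with high probability no component has at most
  \<open>\<epsilon> n\<close> vertices. So if the graph is disconnected, then at least \<open>\<epsilon> n\<^sup>2\<close> pairs of vertices are
  separated, and it suffices that the expected proportion of separated pairs vanishes. Weight the pairs by
  \<open>h (X\<^sub>i) (X\<^sub>j)\<close> for a kernel \<open>h\<close>. For \<open>h = min 1 \<kappa>\<close> the weighted proportion is at most \<open>2 / ln n\<close>: when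
  the potential edges are examined one after the other, each edge that joins two different components reduces
  their number. By the law of large numbers and transitivity of connectedness the property passes from \<open>h\<close>
  and \<open>k\<close> to their composition \<open>\<integral> h x z k z y dz\<close>. Irreducibility says that almost everywhere some iterated
  composition of \<open>min 1 \<kappa>\<close> is positive, which gives the property for \<open>h = 1\<close>.\<close>

section \<open>Merging components by random edges\<close>

definition undirected :: "('v \<times> 'v \<Rightarrow> bool) \<Rightarrow> ('v \<times> 'v) set" where
  "undirected e = {(i, j). e (i, j) \<or> e (j, i)}"

lemma sym_undirected: "sym (undirected e)"
  by (auto simp: undirected_def sym_def)

lemma undirected_mono: "e \<le> e' \<Longrightarrow> undirected e \<subseteq> undirected e'"
  by (auto simp: undirected_def le_fun_def)

text \<open>For symmetric \<open>E\<close> every class of connected vertices is represented by its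
  least element, so the cardinality counts components. Unlike quotients, these sets are nested when
  edges are added.\<close>

definition class_minima :: "'v::wellorder set \<Rightarrow> ('v \<times> 'v) set \<Rightarrow> 'v set" where
  "class_minima V E = {v \<in> V. \<forall>u\<in>V. (u, v) \<in> E\<^sup>* \<longrightarrow> v \<le> u}"

lemma class_minima_antimono:
  assumes "E \<subseteq> E'"
  shows "class_minima V E' \<subseteq> class_minima V E"
  using rtrancl_mono[OF assms] by (auto simp: class_minima_def)

lemma card_class_minima_mono:
  assumes "finite V" "E \<subseteq> E'"
  shows "card (class_minima V E') \<le> card (class_minima V E)"
  using assms by (intro card_mono class_minima_antimono) (auto simp: class_minima_def)

text \<open>The least elements \<open>m a\<close> and \<open>m b\<close> of the two old classes
  differ. In \<open>E'\<close> they share a class, so one of them stops being a minimum, while no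
  new minimum appears.\<close>

lemma card_class_minima_less:
  assumes V: "finite V" "a \<in> V" "b \<in> V" and E: "E \<subseteq> E'" "sym E" "sym E'"
    and new: "(a, b) \<in> E'\<^sup>*" "(a, b) \<notin> E\<^sup>*"
  shows "card (class_minima V E') < card (class_minima V E)"
proof (rule psubset_card_mono)
  show "finite (class_minima V E)"
    using V by (auto simp: class_minima_def)
  have symE: "(u, v) \<in> E\<^sup>* \<Longrightarrow> (v, u) \<in> E\<^sup>*" and symE': "(u, v) \<in> E'\<^sup>* \<Longrightarrow> (v, u) \<in> E'\<^sup>*" for u v
    using E by (meson sym_rtrancl symD)+
  define m where "m w = (LEAST u. u \<in> V \<and> (u, w) \<in> E\<^sup>*)" for w
  have m: "m w \<in> V" "(m w, w) \<in> E\<^sup>*" if "w \<in> V" for w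
    using LeastI[of "\<lambda>u. u \<in> V \<and> (u, w) \<in> E\<^sup>*" w] that by (auto simp: m_def)
  have m_le: "m w \<le> u" if "u \<in> V" "(u, w) \<in> E\<^sup>*" for u w
    unfolding m_def by (rule Least_le) (use that in auto)
  have min: "m w \<in> class_minima V E" if "w \<in> V" for w
    using m[OF that] m_le by (auto simp: class_minima_def intro: rtrancl_trans)
  have ne: "m a \<noteq> m b"
    using m[OF V(2)] m[OF V(3)] new(2) symE by (metis rtrancl_trans)
  have "(m a, m b) \<in> E'\<^sup>*"
    using m[OF V(2)] m[OF V(3)] new(1) symE' rtrancl_mono[OF E(1)] by (meson rtrancl_trans subsetD)
  then have "\<not> (m a \<in> class_minima V E' \<and> m b \<in> class_minima V E')"
    using ne m[OF V(2)] m[OF V(3)] symE' by (force simp: class_minima_def)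
  then show "class_minima V E' \<subset> class_minima V E"
    using class_minima_antimono[OF E(1)] min[OF V(2)] min[OF V(3)] by blast
qed

lemma expectation_Pi_bernoulli_insert:
  fixes F :: "('v \<Rightarrow> bool) \<Rightarrow> real"
  assumes A: "finite A" "a \<notin> A" and p: "0 \<le> p a" "p a \<le> 1"
  shows "measure_pmf.expectation (Pi_pmf (insert a A) False (\<lambda>x. bernoulli_pmf (p x))) F =
    p a * measure_pmf.expectation (Pi_pmf A False (\<lambda>x. bernoulli_pmf (p x))) (\<lambda>e. F (e(a := True))) +
    (1 - p a) * measure_pmf.expectation (Pi_pmf A False (\<lambda>x. bernoulli_pmf (p x))) F"
proof -
  let ?Q = "Pi_pmf A False (\<lambda>x. bernoulli_pmf (p x))"
  have fin: "finite (set_pmf ?Q)"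
    by (rule finite_subset[OF set_Pi_pmf_subset'[OF A(1)]]) (auto intro: A)
  \<comment> \<open>Coordinates outside \<open>A\<close> have the default value \<open>False\<close>
    almost surely, so closing \<open>a\<close> changes nothing.\<close>
  have off: "measure_pmf.expectation ?Q (\<lambda>e. F (e(a := False))) = measure_pmf.expectation ?Q F"
  proof (rule integral_cong_AE)
    show "AE e in ?Q. F (e(a := False)) = F e"
      using set_Pi_pmf_subset[OF A(1), of False "\<lambda>x. bernoulli_pmf (p x)"] A(2)
      by (auto simp: AE_measure_pmf_iff fun_upd_idem)
  qed auto
  have "measure_pmf.expectation (Pi_pmf (insert a A) False (\<lambda>x. bernoulli_pmf (p x))) F =
    measure_pmf.expectation (bernoulli_pmf (p a)) (\<lambda>y. measure_pmf.expectation ?Q (\<lambda>e. F (e(a := y))))"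
    unfolding Pi_pmf_insert'[OF A] map_pmf_def[symmetric] using p fin
    by (subst pmf_expectation_bind[where A=UNIV]) (auto simp: UNIV_bool)
  also have "\<dots> = p a * measure_pmf.expectation ?Q (\<lambda>e. F (e(a := True))) +
      (1 - p a) * measure_pmf.expectation ?Q (\<lambda>e. F (e(a := False)))"
    using p by simp
  finally show ?thesis
    unfolding off .
qed

text \<open>Reveal the pairs one after the other. An open pair whose ends lie in different classes
  lowers the number of classes by at least one, and there are at most \<open>card V\<close> classes
  at the start. A pair separated at the end was already separated when it was revealed. Keeping the
  expected number of remaining classes in the bound makes the induction go through.\<close>

lemma expected_merges_le:
  fixes V :: "'v::wellorder set" and p :: "'v \<times> 'v \<Rightarrow> real"
  assumes V: "finite V" and A: "finite A" "A \<subseteq> V \<times> V" and p: "\<And>a. a \<in> A \<Longrightarrow> 0 \<le> p a \<and> p a \<le> 1"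
  defines "Q \<equiv> \<lambda>A. Pi_pmf A False (\<lambda>a. bernoulli_pmf (p a))"
  shows "(\<Sum>a\<in>A. p a * measure_pmf.prob (Q A) {e. a \<notin> (undirected e)\<^sup>*})
    + measure_pmf.expectation (Q A) (\<lambda>e. real (card (class_minima V (undirected e)))) \<le> card V"
  using A p
proof (induction A rule: finite_induct)
  case empty
  show ?case
    using V by (auto simp: Q_def class_minima_def intro!: card_mono)
next
  case (insert a A)
  let ?c = "\<lambda>e. real (card (class_minima V (undirected e)))"
  let ?E = "\<lambda>A. measure_pmf.expectation (Q A)"
  let ?u = "\<lambda>b e. of_bool (b \<notin> (undirected e)\<^sup>*) :: real"
  have prob_eq: "measure_pmf.prob (Q A) {e. b \<notin> (undirected e)\<^sup>*} = ?E A (?u b)" for A b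
  proof -
    have "?u b = indicator {e. b \<notin> (undirected e)\<^sup>*}"
      by (auto simp: indicator_def)
    then show ?thesis by simp
  qed
  have c_le: "\<bar>?c e\<bar> \<le> card V" for e
    using V by (auto simp: class_minima_def intro!: card_mono)
  have int: "integrable (Q A) F" if "\<And>e. \<bar>F e\<bar> \<le> B" for A B and F :: "_ \<Rightarrow> real"
    by (rule measure_pmf.integrable_const_bound[where B=B]) (use that in auto)
  have pa: "0 \<le> p a" "p a \<le> 1"
    using insert.prems by auto
  have step: "?E (insert a A) F = p a * ?E A (\<lambda>e. F (e(a := True))) + (1 - p a) * ?E A F" for F :: "_ \<Rightarrow> real"
    unfolding Q_def using insert(1,2) pa by (rule expectation_Pi_bernoulli_insert)
  have up: "undirected e \<subseteq> undirected (e(a := True))" for e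
    by (rule undirected_mono) (auto simp: le_fun_def)
  \<comment> \<open>Opening a further pair only enlarges classes, so separation becomes less
    likely.\<close>
  have mono: "?E (insert a A) (?u b) \<le> ?E A (?u b)" for b
  proof -
    have "?E A (\<lambda>e. ?u b (e(a := True))) \<le> ?E A (?u b)"
      using rtrancl_mono[OF up] by (intro integral_mono int[of _ 1]) auto
    with pa have "p a * ?E A (\<lambda>e. ?u b (e(a := True))) \<le> p a * ?E A (?u b)"
      by (intro mult_left_mono)
    then show ?thesis
      unfolding step[of "?u b"] by (simp add: algebra_simps)
  qed
  \<comment> \<open>Pointwise: if the ends of \<open>a\<close> are separated, opening
    \<open>a\<close> destroys a class minimum.\<close>
  have merge: "?E A (?u a) + ?E A (\<lambda>e. ?c (e(a := True))) \<le> ?E A ?c"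
  proof -
    have "?E A (?u a) + ?E A (\<lambda>e. ?c (e(a := True))) = ?E A (\<lambda>e. ?u a e + ?c (e(a := True)))"
      by (intro Bochner_Integration.integral_add[symmetric] int[of _ 1] int[of _ "card V"] c_le) auto
    also have "\<dots> \<le> ?E A ?c"
    proof (intro integral_mono)
      show "integrable (Q A) (\<lambda>e. ?u a e + ?c (e(a := True)))"
        by (intro Bochner_Integration.integrable_add int[of "?u a" 1] int[OF c_le]) auto
      show "integrable (Q A) ?c"
        by (rule int[OF c_le])
      fix e
      show "?u a e + ?c (e(a := True)) \<le> ?c e"
      proof (cases "a \<in> (undirected e)\<^sup>*")
        case True
        then show ?thesis using card_class_minima_mono[OF V up] by auto
      next
        case False
        obtain i j where a: "a = (i, j)" by force
        have "(i, j) \<in> (undirected (e(a := True)))\<^sup>*"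
          by (auto simp: undirected_def a)
        then have "card (class_minima V (undirected (e(a := True)))) < card (class_minima V (undirected e))"
          using insert.prems False unfolding a
          by (intro card_class_minima_less[OF V, of i j] up[unfolded a] sym_undirected) auto
        then show ?thesis using False by auto
      qed
    qed
    finally show ?thesis .
  qed
  have cexp: "?E (insert a A) ?c = p a * ?E A (\<lambda>e. ?c (e(a := True))) + (1 - p a) * ?E A ?c"
    by (rule step)
  have "(\<Sum>b\<in>insert a A. p b * ?E (insert a A) (?u b)) \<le> (\<Sum>b\<in>insert a A. p b * ?E A (?u b))"
    using insert.prems by (intro sum_mono mult_left_mono mono) auto
  also have "\<dots> = p a * ?E A (?u a) + (\<Sum>b\<in>A. p b * ?E A (?u b))"
    using insert.hyps by simp
  also have "\<dots> \<le> p a * ?E A (?u a) + (card V - ?E A ?c)"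
    using insert.IH insert.prems by (auto simp: prob_eq)
  finally have "(\<Sum>b\<in>insert a A. p b * ?E (insert a A) (?u b)) + ?E (insert a A) ?c
      \<le> p a * ?E A (?u a) + (card V - ?E A ?c) + ?E (insert a A) ?c" by simp
  \<comment> \<open>By \<open>merge\<close> the bracket is at most 0: the drop in the number of
    classes pays for the new summand.\<close>
  also have "\<dots> = card V + p a * (?E A (?u a) + ?E A (\<lambda>e. ?c (e(a := True))) - ?E A ?c)"
    unfolding cexp by (simp add: algebra_simps)
  also have "\<dots> \<le> card V"
    using merge pa by (auto intro!: mult_nonneg_nonpos)
  finally show ?case
    unfolding prob_eq .
qed

section \<open>Separation events\<close>

lemma parcs_graph_of_subset: "parcs (graph_of n e) \<subseteq> {1..n} \<times> {1..n}"
  by (auto simp: graph_of_def vertex_pairs_def)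

lemma sym_parcs_graph_of: "sym (parcs (graph_of n e))"
  by (auto simp: graph_of_def sym_def)

lemma parcs_graph_of_eq_undirected:
  assumes "\<And>a. a \<notin> vertex_pairs n \<Longrightarrow> \<not> e a"
  shows "parcs (graph_of n e) = undirected e"
  using assms by (auto simp: graph_of_def undirected_def)

text \<open>The arcs form a symmetric relation inside the vertex set, so symmetric closure and
  restriction of paths to vertices change nothing. The empty graph does not count as
  connected.\<close>

lemma connected_graph_of_iff:
  "Digraph_Component.connected (with_proj (graph_of n e)) \<longleftrightarrow>
    n \<noteq> 0 \<and> (\<forall>i\<in>{1..n}. \<forall>j\<in>{1..n}. (i, j) \<in> (parcs (graph_of n e))\<^sup>*)"
proof -
  let ?E = "parcs (graph_of n e)"
  have ends: "arcs_ends (with_proj (graph_of n e)) = ?E"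
    by (auto simp: arcs_ends_def arc_to_ends_def)
  have symcl: "symcl ?E = ?E"
    using sym_parcs_graph_of[of n e] by (auto simp: symcl_def sym_def)
  have "(i, j) \<in> rtrancl_on {1..n} ?E \<longleftrightarrow> (i, j) \<in> ?E\<^sup>*" if "i \<in> {1..n}" for i j
  proof
    show "(i, j) \<in> rtrancl_on {1..n} ?E \<Longrightarrow> (i, j) \<in> ?E\<^sup>*"
      by (rule rtrancl_on_rtranclI)
    assume "(i, j) \<in> ?E\<^sup>*"
    then show "(i, j) \<in> rtrancl_on {1..n} ?E"
    proof induction
      case (step y z)
      then show ?case using parcs_graph_of_subset[of n e] by (auto intro: rtrancl_on_into_rtrancl_on)
    qed (use that in auto)
  qed
  then show ?thesis
    unfolding connected_conv ends symcl by (auto simp: graph_of_def)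
qed

text \<open>In a symmetric graph this says that \<open>S\<close> is a union of components, not that
  it is a single one. It constrains only the crossing pairs, so its conditional probability is a
  product.\<close>

definition no_cross :: "nat \<Rightarrow> nat set \<Rightarrow> nat pair_pre_digraph \<Rightarrow> bool" where
  "no_cross n S G \<longleftrightarrow> (\<forall>i\<in>S. \<forall>j\<in>{1..n} - S. (i, j) \<notin> parcs G)"

lemma connected_imp_not_no_cross:
  assumes conn: "Digraph_Component.connected (with_proj (graph_of n e))" and i: "i \<in> S" "S \<subset> {1..n}"
  shows "\<not> no_cross n S (graph_of n e)"
proof
  let ?E = "parcs (graph_of n e)"
  assume nc: "no_cross n S (graph_of n e)"
  obtain j where j: "j \<in> {1..n}" "j \<notin> S" using i(2) by blast
  have "(i, j) \<in> ?E\<^sup>*"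
    using conn i j unfolding connected_graph_of_iff by auto
  then have "j \<in> S"
    by induction (use i nc parcs_graph_of_subset[of n e] in \<open>auto simp: no_cross_def\<close>)
  with j show False by simp
qed

lemma no_cross_class: "no_cross n ((parcs G)\<^sup>* `` {i} \<inter> {1..n}) G"
  by (auto simp: no_cross_def intro: rtrancl_into_rtrancl)

text \<open>In a disconnected graph each vertex \<open>i\<close> misses some \<open>j\<close>, hence
  the whole component of \<open>j\<close>. That component has no crossing edge, so
  \<open>large\<close> applies to it; summing over \<open>i\<close> gives the count.\<close>

lemma many_separated_pairs:
  fixes \<epsilon> :: real
  assumes n: "n \<noteq> 0" and disc: "\<not> Digraph_Component.connected (with_proj (graph_of n e))"
    and large: "\<And>S. S \<subseteq> {1..n} \<Longrightarrow> S \<noteq> {} \<Longrightarrow> no_cross n S (graph_of n e) \<Longrightarrow> \<epsilon> * n < card S"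
  shows "\<epsilon> * n * n \<le> card {a \<in> {1..n} \<times> {1..n}. a \<notin> (parcs (graph_of n e))\<^sup>*}"
proof -
  let ?E = "parcs (graph_of n e)"
  have sep: "\<epsilon> * n \<le> card {j \<in> {1..n}. (i, j) \<notin> ?E\<^sup>*}" if i: "i \<in> {1..n}" for i
  proof -
    have symE: "sym (?E\<^sup>*)"
      by (rule sym_rtrancl[OF sym_parcs_graph_of])
    have "\<exists>j\<in>{1..n}. (i, j) \<notin> ?E\<^sup>*"
    proof (rule ccontr)
      assume "\<not> ?thesis"
      then have "(a, b) \<in> ?E\<^sup>*" if "a \<in> {1..n}" "b \<in> {1..n}" for a b
        using that symE by (meson rtrancl_trans symD)
      with disc n show False by (auto simp: connected_graph_of_iff)
    qed
    then obtain j where j: "j \<in> {1..n}" "(i, j) \<notin> ?E\<^sup>*" by auto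
    let ?C = "?E\<^sup>* `` {j} \<inter> {1..n}"
    have "\<epsilon> * n \<le> card ?C"
      using large[OF _ _ no_cross_class] j by fastforce
    also have "card ?C \<le> card {j \<in> {1..n}. (i, j) \<notin> ?E\<^sup>*}"
      using j symE by (intro card_mono) (auto dest: rtrancl_trans symD)
    finally show ?thesis by simp
  qed
  have "{a \<in> {1..n} \<times> {1..n}. a \<notin> ?E\<^sup>*} = (SIGMA i:{1..n}. {j \<in> {1..n}. (i, j) \<notin> ?E\<^sup>*})"
    by auto
  then have "real (card {a \<in> {1..n} \<times> {1..n}. a \<notin> ?E\<^sup>*}) = (\<Sum>i\<in>{1..n}. card {j \<in> {1..n}. (i, j) \<notin> ?E\<^sup>*})"
    by (subst card_SigmaI[symmetric]) auto
  also have "\<dots> \<ge> (\<Sum>i\<in>{1..n}. \<epsilon> * n)"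
    unfolding of_nat_sum by (intro sum_mono sep)
  finally show ?thesis by (simp add: mult_ac)
qed

section \<open>Conditional probabilities given the positions\<close>

lemma measure_Pi_bernoulli_none:
  assumes A: "finite A" "D \<subseteq> A" and p: "\<And>a. a \<in> A \<Longrightarrow> 0 \<le> p a \<and> p a \<le> 1"
  shows "measure_pmf.prob (Pi_pmf A False (\<lambda>a. bernoulli_pmf (p a))) {e. \<forall>a\<in>D. \<not> e a} = (\<Prod>a\<in>D. 1 - p a)"
proof -
  have "{e. \<forall>a\<in>D. \<not> e a} = Pi A (\<lambda>a. if a \<in> D then {False} else UNIV)"
    using A by (auto simp: Pi_iff split: if_splits)
  then have "measure_pmf.prob (Pi_pmf A False (\<lambda>a. bernoulli_pmf (p a))) {e. \<forall>a\<in>D. \<not> e a}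
      = (\<Prod>a\<in>A. measure_pmf.prob (bernoulli_pmf (p a)) (if a \<in> D then {False} else UNIV))"
    by (simp add: measure_Pi_pmf_Pi[OF A(1)])
  also have "\<dots> = (\<Prod>a\<in>A. if a \<in> D then 1 - p a else 1)"
    using p by (intro prod.cong) (auto simp: measure_pmf_single)
  also have "\<dots> = (\<Prod>a\<in>D. 1 - p a)"
    using A by (subst prod.inter_restrict[symmetric]) (auto simp: Int_absorb1)
  finally show ?thesis .
qed

lemma edge_prob_bounds:
  assumes "\<And>x y. 0 \<le> \<kappa> x y"
  shows "0 \<le> edge_prob \<kappa> n x a" "edge_prob \<kappa> n x a \<le> 1"
proof -
  have "0 \<le> ln (real n) / real n" by (cases n) auto
  then have "0 \<le> \<kappa> y z * (ln (real n) / real n)" for y z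
    using assms by (intro mult_nonneg_nonneg)
  then show "0 \<le> edge_prob \<kappa> n x a" "edge_prob \<kappa> n x a \<le> 1"
    by (auto simp: edge_prob_def simp del: times_divide_eq_right split: prod.split)
qed

text \<open>The outer product runs over the vertices outside \<open>S\<close>: with the points of
  \<open>S\<close> fixed, its factors involve different \<open>x j\<close> and become
  independent.\<close>

lemma measure_cond_no_cross:
  assumes \<kappa>: "\<And>x y. 0 \<le> \<kappa> x y" "\<And>x y. \<kappa> x y = \<kappa> y x" and S: "S \<subseteq> {1..n}"
  shows "measure_pmf.prob (cond_graph_pmf \<kappa> n x) {G. no_cross n S G}
    = (\<Prod>j\<in>{1..n} - S. \<Prod>i\<in>S. 1 - edge_prob \<kappa> n x (i, j))"
proof -
  let ?D = "{(i, j) \<in> vertex_pairs n. (i \<in> S) \<noteq> (j \<in> S)}"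
  have ev: "graph_of n -` {G. no_cross n S G} = {e. \<forall>a\<in>?D. \<not> e a}"
  proof (intro equalityI subsetI)
    fix e assume "e \<in> graph_of n -` {G. no_cross n S G}"
    then have *: "(i, j) \<notin> parcs (graph_of n e)" if "i \<in> S" "j \<in> {1..n}" "j \<notin> S" for i j
      using that by (auto simp: no_cross_def)
    have "\<not> e (i, j)" if "(i, j) \<in> vertex_pairs n" "(i \<in> S) \<noteq> (j \<in> S)" for i j
      using that *[of i j] *[of j i] by (auto simp: vertex_pairs_def graph_of_def)
    then show "e \<in> {e. \<forall>a\<in>?D. \<not> e a}" by auto
  qed (auto simp: no_cross_def graph_of_def)
  have "measure_pmf.prob (cond_graph_pmf \<kappa> n x) {G. no_cross n S G} = (\<Prod>a\<in>?D. 1 - edge_prob \<kappa> n x a)"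
    unfolding cond_graph_pmf_def measure_map_pmf ev
    by (rule measure_Pi_bernoulli_none) (auto intro: edge_prob_bounds \<kappa>)
  \<comment> \<open>\<open>vertex_pairs\<close> stores a crossing pair once, in increasing order;
    the bijection lists it as outside vertex, inside vertex. Symmetry of \<open>\<kappa>\<close>
    gives both orders the same weight.\<close>
  also have "\<dots> = (\<Prod>(j, i)\<in>({1..n} - S) \<times> S. 1 - edge_prob \<kappa> n x (i, j))"
    by (rule prod.reindex_bij_witness[where i="\<lambda>(j, i). (min i j, max i j)"
          and j="\<lambda>(i, j). if i \<in> S then (j, i) else (i, j)"])
      (use S in \<open>auto simp: vertex_pairs_def edge_prob_def \<kappa>(2) min_def max_def split: if_splits
          intro!: le_neq_implies_less\<close>)
  also have "\<dots> = (\<Prod>j\<in>{1..n} - S. \<Prod>i\<in>S. 1 - edge_prob \<kappa> n x (i, j))"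
    using S finite_subset[OF S] by (subst prod.cartesian_product) auto
  finally show ?thesis .
qed

text \<open>This is \<open>expected_merges_le\<close> with the number of remaining components
  bounded below by 0.\<close>

lemma sum_edge_prob_separated_le:
  assumes \<kappa>: "\<And>x y. 0 \<le> \<kappa> x y"
  shows "(\<Sum>a\<in>vertex_pairs n. edge_prob \<kappa> n x a *
    measure_pmf.prob (cond_graph_pmf \<kappa> n x) {G. a \<notin> (parcs G)\<^sup>*}) \<le> n"
proof -
  let ?Q = "Pi_pmf (vertex_pairs n) False (\<lambda>a. bernoulli_pmf (edge_prob \<kappa> n x a))"
  have prob: "measure_pmf.prob (cond_graph_pmf \<kappa> n x) {G. a \<notin> (parcs G)\<^sup>*} =
      measure_pmf.prob ?Q {e. a \<notin> (undirected e)\<^sup>*}" for a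
    unfolding cond_graph_pmf_def measure_map_pmf
  proof (rule measure_pmf.finite_measure_eq_AE)
    \<comment> \<open>The two relations agree on the support of \<open>?Q\<close>, where no pair
      outside \<open>vertex_pairs n\<close> is open.\<close>
    have "parcs (graph_of n e) = undirected e" if "e \<in> set_pmf ?Q" for e
      using that set_Pi_pmf_subset[of "vertex_pairs n" False "\<lambda>a. bernoulli_pmf (edge_prob \<kappa> n x a)"]
      by (intro parcs_graph_of_eq_undirected) auto
    then show "AE e in ?Q. e \<in> graph_of n -` {G. a \<notin> (parcs G)\<^sup>*} \<longleftrightarrow> e \<in> {e. a \<notin> (undirected e)\<^sup>*}"
      by (simp add: AE_measure_pmf_iff)
  qed auto
  have "vertex_pairs n \<subseteq> {1..n} \<times> {1..n}"
    by (auto simp: vertex_pairs_def)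
  then have "(\<Sum>a\<in>vertex_pairs n. edge_prob \<kappa> n x a * measure_pmf.prob ?Q {e. a \<notin> (undirected e)\<^sup>*})
      + measure_pmf.expectation ?Q (\<lambda>e. real (card (class_minima {1..n} (undirected e)))) \<le> card {1..n}"
    by (intro expected_merges_le) (auto simp: edge_prob_bounds \<kappa>)
  moreover have "0 \<le> measure_pmf.expectation ?Q (\<lambda>e. real (card (class_minima {1..n} (undirected e))))"
    by (intro integral_nonneg_AE) auto
  ultimately show ?thesis
    unfolding prob card_atLeastAtMost by linarith
qed

section \<open>Vertex sets without outgoing edges\<close>

text \<open>The right-hand side times \<open>1 + u + u^2 / 2\<close> equals
  \<open>1 + u^4 / 4\<close>, which is at least 1, and that second factor is at most
  \<open>exp u\<close>.\<close>

lemma exp_minus_le_quadratic: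
  fixes u :: real
  assumes "0 \<le> u"
  shows "exp (- u) \<le> 1 - u + u\<^sup>2 / 2"
proof -
  have pos: "0 < 1 + u + u\<^sup>2 / 2"
    using assms by (auto intro!: add_pos_nonneg)
  have "(1 - u + u\<^sup>2 / 2) * (1 + u + u\<^sup>2 / 2) = 1 + (u\<^sup>2)\<^sup>2 / 4"
    by (simp add: algebra_simps power2_eq_square)
  then have "1 \<le> (1 - u + u\<^sup>2 / 2) * (1 + u + u\<^sup>2 / 2)"
    by simp
  then have "1 / (1 + u + u\<^sup>2 / 2) \<le> 1 - u + u\<^sup>2 / 2"
    using pos by (simp add: pos_divide_le_eq)
  moreover have "exp (- u) \<le> 1 / (1 + u + u\<^sup>2 / 2)"
    using exp_lower_Taylor_quadratic[OF assms] pos by (simp add: exp_minus inverse_eq_divide frac_le)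
  ultimately show ?thesis by simp
qed

text \<open>What remains of homogeneity. Square integrability is required of every section rather
  than almost every one, so that moment bounds hold for all positions of the vertices.\<close>

locale regular_kernel = prob_space M for M :: "'a measure" +
  fixes \<kappa> :: "'a \<Rightarrow> 'a \<Rightarrow> real"
  assumes space_UNIV: "space M = UNIV"
    and kernel_nonneg: "\<And>x y. 0 \<le> \<kappa> x y"
    and kernel_sym: "\<And>x y. \<kappa> x y = \<kappa> y x"
    and kernel_measurable': "(\<lambda>(x, y). \<kappa> x y) \<in> borel_measurable (M \<Otimes>\<^sub>M M)"
    and same_law: "\<And>x y. distr M borel (\<kappa> x) = distr M borel (\<kappa> y)"
    and sq_integrable: "\<And>x. integrable M (\<lambda>y. (\<kappa> x y)\<^sup>2)"
begin

sublocale P: product_prob_space "\<lambda>_ :: nat. M" ..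

lemma prob_space_points: "prob_space (\<Pi>\<^sub>M i\<in>I. M)"
  by (rule prob_space_PiM) (rule prob_space_axioms)

lemma kernel_measurable [measurable (raw)]:
  assumes "f \<in> N \<rightarrow>\<^sub>M M" "g \<in> N \<rightarrow>\<^sub>M M"
  shows "(\<lambda>x. \<kappa> (f x) (g x)) \<in> borel_measurable N"
  using measurable_compose[OF measurable_Pair[OF assms] kernel_measurable'] by simp

lemma const_measurable [measurable]: "(\<lambda>_. x) \<in> N \<rightarrow>\<^sub>M M"
  by (simp add: space_UNIV)

text \<open>The constant value of lambda. All sections have the same law, so the base point
  \<open>undefined\<close> is as good as any other.\<close>

definition deg :: real where "deg = (\<integral>y. \<kappa> undefined y \<partial>M)"

definition sq :: real where "sq = (\<integral>y. (\<kappa> undefined y)\<^sup>2 \<partial>M)"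

lemma integral_kernel_eq:
  fixes f :: "real \<Rightarrow> real"
  assumes [measurable]: "f \<in> borel_measurable borel"
  shows "(\<integral>z. f (\<kappa> x z) \<partial>M) = (\<integral>z. f (\<kappa> y z) \<partial>M)"
  using same_law[of x y] integral_distr[of "\<kappa> x" M borel f] integral_distr[of "\<kappa> y" M borel f] by simp

lemma integral_kernel: "(\<integral>z. \<kappa> x z \<partial>M) = deg"
  unfolding deg_def by (rule integral_kernel_eq[of "\<lambda>t. t"]) simp

lemma integral_kernel_sq: "(\<integral>z. (\<kappa> x z)\<^sup>2 \<partial>M) = sq"
  unfolding sq_def by (rule integral_kernel_eq[of "\<lambda>t. t\<^sup>2"]) simp

lemma kernel_integrable: "integrable M (\<kappa> x)"
  using sq_integrable[of x] by (rule square_integrable_imp_integrable[rotated]) simp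

lemma deg_nonneg: "0 \<le> deg"
  unfolding deg_def by (intro integral_nonneg_AE) (simp add: kernel_nonneg)

lemma sq_nonneg: "0 \<le> sq"
  unfolding sq_def by (intro integral_nonneg_AE) simp

abbreviation "\<G> n \<equiv> random_graph M \<kappa> n"

lemma cond_measurable:
  "(\<lambda>x. measure_pmf (cond_graph_pmf \<kappa> n x)) \<in> (\<Pi>\<^sub>M i\<in>{1..n}. M) \<rightarrow>\<^sub>M subprob_algebra (count_space UNIV)"
  by (rule measurable_cond_graph_pmf[OF kernel_measurable' kernel_nonneg])

lemma prob_cond_measurable [measurable]:
  "(\<lambda>x. measure_pmf.prob (cond_graph_pmf \<kappa> n x) A) \<in> borel_measurable (\<Pi>\<^sub>M i\<in>{1..n}. M)"
  by (rule measurable_compose[OF cond_measurable]) simp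

lemma space_PiM_nonempty: "space (\<Pi>\<^sub>M i\<in>I. M) \<noteq> {}"
  by (rule prob_space.not_empty) (rule prob_space_points)

lemma sets_random_graph [simp]: "sets (\<G> n) = UNIV"
  unfolding random_graph_def
  by (subst sets_bind[OF subprob_measurableD(2)[OF cond_measurable] space_PiM_nonempty]) auto

lemma space_random_graph [simp]: "space (\<G> n) = UNIV"
  using sets.top[of "\<G> n"] sets.sets_into_space[of UNIV "\<G> n"] by auto

lemma prob_space_kernel_graph: "prob_space (\<G> n)"
  by (rule prob_space_random_graph[OF prob_space_axioms kernel_measurable' kernel_nonneg])

lemma measure_random_graph:
  "measure (\<G> n) A = (\<integral>x. measure_pmf.prob (cond_graph_pmf \<kappa> n x) A \<partial>(\<Pi>\<^sub>M i\<in>{1..n}. M))"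
proof -
  interpret I: prob_space "\<Pi>\<^sub>M i\<in>{1..n}. M"
    by (rule prob_space_points)
  show ?thesis
    unfolding random_graph_def by (rule I.measure_bind[OF cond_measurable]) simp
qed

text \<open>The sample space contains every digraph on the naturals; this confines it to the
  symmetric graphs on \<open>{1..n}\<close>, to which the combinatorial lemmas apply.\<close>

lemma AE_random_graph: "AE G in \<G> n. \<exists>e. G = graph_of n e"
proof -
  interpret R: prob_space "\<G> n" by (rule prob_space_kernel_graph)
  interpret I: prob_space "\<Pi>\<^sub>M i\<in>{1..n}. M"
    by (rule prob_space_points)
  have "measure_pmf.prob (cond_graph_pmf \<kappa> n x) (range (graph_of n)) = 1" for x
    by (subst measure_pmf.prob_eq_1) (auto simp: AE_measure_pmf_iff cond_graph_pmf_def)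
  then have "measure (\<G> n) (range (graph_of n)) = 1"
    unfolding measure_random_graph by (simp add: I.prob_space del: One_nat_def)
  then show ?thesis
    using R.prob_eq_1[of "range (graph_of n)"] by auto
qed

text \<open>The conditional probability, given the points of \<open>S\<close>, that one further
  random vertex has no edge to \<open>S\<close>.\<close>

definition avoid_prob :: "nat \<Rightarrow> nat set \<Rightarrow> (nat \<Rightarrow> 'a) \<Rightarrow> real" where
  "avoid_prob n S x = (\<integral>z. (\<Prod>i\<in>S. 1 - min 1 (\<kappa> (x i) z * (ln n / n))) \<partial>M)"

lemma non_edge_bounds: "0 \<le> 1 - min 1 (\<kappa> x y * (ln n / n))" "1 - min 1 (\<kappa> x y * (ln (real n) / n)) \<le> 1"
  using edge_prob_bounds[of \<kappa> n "\<lambda>i. if i = 0 then x else y" "(0, 1)"] kernel_nonneg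
  by (auto simp: edge_prob_def)

lemma prod_non_edge_bounds:
  "0 \<le> (\<Prod>i\<in>S. 1 - min 1 (\<kappa> (x i) z * (ln (real n) / n)))"
  "(\<Prod>i\<in>S. 1 - min 1 (\<kappa> (x i) z * (ln (real n) / n))) \<le> 1"
  using non_edge_bounds by (auto intro!: prod_nonneg prod_le_1 simp del: diff_ge_0_iff_ge)

lemma prod_non_edge_integrable: "integrable M (\<lambda>z. \<Prod>i\<in>S. 1 - min 1 (\<kappa> (x i) z * (ln (real n) / n)))"
proof (intro integrable_const_bound[where B=1] AE_I2)
  show "norm (\<Prod>i\<in>S. 1 - min 1 (\<kappa> (x i) z * (ln (real n) / n))) \<le> 1" for z
    unfolding real_norm_def abs_of_nonneg[OF prod_non_edge_bounds(1)] by (rule prod_non_edge_bounds(2))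
qed measurable

lemma avoid_prob_bounds: "0 \<le> avoid_prob n S x" "avoid_prob n S x \<le> 1"
  unfolding avoid_prob_def
  by (intro integral_nonneg_AE integral_le_const AE_I2 prod_non_edge_integrable prod_non_edge_bounds)+

text \<open>By Fubini, fix the points of \<open>S\<close> first. The other \<open>n - card S\<close>
  vertices then avoid \<open>S\<close> independently, each with probability
  \<open>avoid_prob n S x\<close>.\<close>

lemma prob_no_cross:
  assumes S: "S \<subseteq> {1..n}"
  shows "measure (\<G> n) {G. no_cross n S G} = (\<integral>x. avoid_prob n S x ^ (n - card S) \<partial>(\<Pi>\<^sub>M i\<in>S. M))"
proof -
  let ?J = "{1..n} - S"
  let ?p = "\<lambda>x y. 1 - min 1 (\<kappa> x y * (ln (real n) / n))"
  have fin: "finite S" using S finite_subset by blast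
  have un: "S \<union> ?J = {1..n}" using S by auto
  interpret I: prob_space "\<Pi>\<^sub>M i\<in>{1..n}. M"
    by (rule prob_space_points)
  let ?f = "\<lambda>x. \<Prod>j\<in>?J. \<Prod>i\<in>S. ?p (x i) (x j)"
  have "?f x \<ge> 0" "?f x \<le> 1" for x
    by (intro prod_nonneg prod_le_1 conjI prod_non_edge_bounds)+
  moreover have "?f \<in> borel_measurable (\<Pi>\<^sub>M i\<in>{1..n}. M)"
    by (intro borel_measurable_prod borel_measurable_diff borel_measurable_const borel_measurable_min
        borel_measurable_times kernel_measurable measurable_component_singleton) (use S in auto)
  ultimately have int: "integrable (\<Pi>\<^sub>M i\<in>S \<union> ?J. M) ?f"
    unfolding un by (intro I.integrable_const_bound[where B=1]) (auto simp: abs_le_iff intro: order.trans[of _ 0])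
  have "measure (\<G> n) {G. no_cross n S G} = (\<integral>x. ?f x \<partial>(\<Pi>\<^sub>M i\<in>S \<union> ?J. M))"
    unfolding measure_random_graph un measure_cond_no_cross[OF kernel_nonneg kernel_sym S]
    by (simp add: edge_prob_def)
  also have "\<dots> = (\<integral>x. (\<integral>y. ?f (merge S ?J (x, y)) \<partial>(\<Pi>\<^sub>M i\<in>?J. M)) \<partial>(\<Pi>\<^sub>M i\<in>S. M))"
    using fin int by (intro P.product_integral_fold) auto
  also have "\<dots> = (\<integral>x. (\<integral>y. (\<Prod>j\<in>?J. \<Prod>i\<in>S. ?p (x i) (y j)) \<partial>(\<Pi>\<^sub>M i\<in>?J. M)) \<partial>(\<Pi>\<^sub>M i\<in>S. M))"
    by (intro Bochner_Integration.integral_cong prod.cong refl) (auto simp: merge_def)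
  also have "\<dots> = (\<integral>x. (\<Prod>j\<in>?J. avoid_prob n S x) \<partial>(\<Pi>\<^sub>M i\<in>S. M))"
    unfolding avoid_prob_def
    by (intro Bochner_Integration.integral_cong refl P.product_integral_prod prod_non_edge_integrable) auto
  also have "\<dots> = (\<integral>x. avoid_prob n S x ^ (n - card S) \<partial>(\<Pi>\<^sub>M i\<in>S. M))"
    using S fin by (simp add: card_Diff_subset)
  finally show ?thesis .
qed

text \<open>Dropping the factors outside \<open>T\<close> increases the product, and each remaining
  one is at most an exponential, which is then expanded to second order. The freedom in
  \<open>T\<close> allows \<open>t\<close> to be kept so small that the linear term wins.\<close>

lemma avoid_prob_le:
  assumes T: "finite S" "T \<subseteq> S" and n: "n \<noteq> 0"
  defines "t \<equiv> card T * (ln n / n)"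
  shows "avoid_prob n S x \<le> 1 - t * deg + t\<^sup>2 * sq / 2"
proof -
  let ?p = "ln (real n) / n"
  have p: "0 \<le> ?p" using n by simp
  have finT: "finite T" using T finite_subset by blast
  let ?U = "\<lambda>z. \<Sum>i\<in>T. ?p * \<kappa> (x i) z"
  have U: "0 \<le> ?U z" for z
    using p kernel_nonneg by (intro sum_nonneg mult_nonneg_nonneg) auto
  have "(\<Prod>i\<in>S. 1 - min 1 (\<kappa> (x i) z * ?p)) \<le> 1 - ?U z + card T * (\<Sum>i\<in>T. ?p\<^sup>2 * (\<kappa> (x i) z)\<^sup>2) / 2" for z
  proof -
    have "(\<Prod>i\<in>S. 1 - min 1 (\<kappa> (x i) z * ?p)) =
        (\<Prod>i\<in>T. 1 - min 1 (\<kappa> (x i) z * ?p)) * (\<Prod>i\<in>S - T. 1 - min 1 (\<kappa> (x i) z * ?p))"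
      using T by (simp add: prod.subset_diff mult.commute)
    also have "\<dots> \<le> (\<Prod>i\<in>T. 1 - min 1 (\<kappa> (x i) z * ?p))"
      using prod_non_edge_bounds by (intro mult_left_le) auto
    also have "\<dots> \<le> (\<Prod>i\<in>T. exp (- (?p * \<kappa> (x i) z)))"
    proof (intro prod_mono conjI non_edge_bounds)
      fix i
      show "1 - min 1 (\<kappa> (x i) z * ?p) \<le> exp (- (?p * \<kappa> (x i) z))"
        using exp_ge_add_one_self[of "- (?p * \<kappa> (x i) z)"] exp_ge_zero[of "- (?p * \<kappa> (x i) z)"]
        unfolding min_def by (auto simp: mult.commute simp del: exp_ge_zero)
    qed
    also have "\<dots> = exp (- ?U z)"
      using finT by (simp add: exp_sum sum_negf[symmetric])
    also have "\<dots> \<le> 1 - ?U z + (?U z)\<^sup>2 / 2"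
      by (rule exp_minus_le_quadratic[OF U])
    \<comment> \<open>Cauchy-Schwarz leaves only squares of single kernel values, whose integral is
      \<open>sq\<close> wherever the points lie.\<close>
    also have "(?U z)\<^sup>2 \<le> (\<Sum>i\<in>T. (?p * \<kappa> (x i) z)\<^sup>2) * card T"
      by (rule sum_squared_le_sum_of_squares)
    finally show ?thesis
      by (simp add: mult.commute power_mult_distrib del: times_divide_eq_right times_divide_eq_left)
  qed
  then have "avoid_prob n S x \<le> (\<integral>z. 1 - ?U z + card T * (\<Sum>i\<in>T. ?p\<^sup>2 * (\<kappa> (x i) z)\<^sup>2) / 2 \<partial>M)"
    unfolding avoid_prob_def
    by (intro integral_mono prod_non_edge_integrable Bochner_Integration.integrable_add
        Bochner_Integration.integrable_diff Bochner_Integration.integrable_sum integrable_divide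
        integrable_mult_right kernel_integrable sq_integrable) auto
  also have "\<dots> = 1 - (\<Sum>i\<in>T. ?p * deg) + card T * (\<Sum>i\<in>T. ?p\<^sup>2 * sq) / 2"
    by (simp add: kernel_integrable sq_integrable integral_kernel integral_kernel_sq prob_space
        del: integral_mult_right_zero sum_constant)
  also have "\<dots> = 1 - t * deg + t\<^sup>2 * sq / 2"
    by (simp add: t_def power2_eq_square mult_ac)
  finally show ?thesis .
qed

lemma prob_no_cross_le:
  assumes S: "S \<subseteq> {1..n}" and k: "k \<le> card S" and n: "n \<noteq> 0"
    and t: "t = k * (ln n / n)" "1 - t * deg + t\<^sup>2 * sq / 2 \<le> c"
  shows "measure (\<G> n) {G. no_cross n S G} \<le> c ^ (n - card S)"
proof -
  interpret I: prob_space "\<Pi>\<^sub>M i\<in>S. M"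
    by (rule prob_space_points)
  have fin: "finite S" using S finite_subset by blast
  obtain T where T: "T \<subseteq> S" "card T = k"
    using k obtain_subset_with_card_n by metis
  have le: "avoid_prob n S x ^ (n - card S) \<le> c ^ (n - card S)" for x
    using avoid_prob_le[OF fin T(1) n, of x] T(2) t(2) by (intro power_mono avoid_prob_bounds) (simp_all add: t)
  \<comment> \<open>This covers the case of a non-integrable integrand, whose integral is 0 by
    convention.\<close>
  have "0 \<le> c ^ (n - card S)"
    using order.trans[OF _ le] avoid_prob_bounds by force
  then show ?thesis
    unfolding prob_no_cross[OF S] using le
    by (cases "integrable (\<Pi>\<^sub>M i\<in>S. M) (\<lambda>x. avoid_prob n S x ^ (n - card S))")
      (auto intro: I.integral_le_const simp: not_integrable_integral_eq)
qed

text \<open>For one vertex the avoidance probability depends only on the law of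
  \<open>\<kappa> (x i)\<close>, hence not on its position, and the isolation probability is an
  exact power.\<close>

lemma prob_no_cross_singleton:
  assumes i: "i \<in> {1..n}"
  shows "measure (\<G> n) {G. no_cross n {i} G} = (1 - (\<integral>z. min 1 (\<kappa> undefined z * (ln n / n)) \<partial>M)) ^ (n - 1)"
proof -
  interpret I: prob_space "\<Pi>\<^sub>M j\<in>{i}. M"
    by (rule prob_space_points)
  have int: "integrable M (\<lambda>z. min 1 (\<kappa> x z * (ln n / n)))" for x
    using non_edge_bounds[of x] by (intro integrable_const_bound[where B=1]) (auto simp: abs_le_iff)
  have "avoid_prob n {i} x = 1 - (\<integral>z. min 1 (\<kappa> undefined z * (ln n / n)) \<partial>M)" for x
    unfolding avoid_prob_def using int integral_kernel_eq[of "\<lambda>t. min 1 (t * (ln n / n))" "x i" undefined]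
    by (simp add: prob_space)
  then show ?thesis
    using i by (subst prob_no_cross) (auto simp: I.prob_space)
qed

end

section \<open>Weighted proportion of separated pairs\<close>

context regular_kernel
begin

abbreviation "points n \<equiv> \<Pi>\<^sub>M i\<in>{1..n::nat}. M"

definition separation :: "nat \<Rightarrow> nat \<Rightarrow> nat \<Rightarrow> (nat \<Rightarrow> 'a) \<Rightarrow> real" where
  "separation n i j x = measure_pmf.prob (cond_graph_pmf \<kappa> n x) {G. (i, j) \<notin> (parcs G)\<^sup>*}"

lemma separation_measurable [measurable]: "separation n i j \<in> borel_measurable (points n)"
  unfolding separation_def by (rule prob_cond_measurable)

lemma separation_bounds: "0 \<le> separation n i j x" "separation n i j x \<le> 1"
  by (simp_all add: separation_def)

lemma separation_refl [simp]: "separation n i i x = 0"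
  by (simp add: separation_def)

lemma separation_commute: "separation n i j x = separation n j i x"
  unfolding separation_def
proof (rule measure_pmf.finite_measure_eq_AE)
  show "AE G in cond_graph_pmf \<kappa> n x. G \<in> {G. (i, j) \<notin> (parcs G)\<^sup>*} \<longleftrightarrow> G \<in> {G. (j, i) \<notin> (parcs G)\<^sup>*}"
    using sym_rtrancl[OF sym_parcs_graph_of] by (auto simp: AE_measure_pmf_iff cond_graph_pmf_def dest: symD)
qed auto

text \<open>Transitivity of connectedness and a union bound: for fixed positions, separation is a
  pseudometric on the vertices.\<close>

lemma separation_triangle: "separation n i j x \<le> separation n i k x + separation n k j x"
proof -
  have "separation n i j x \<le> measure_pmf.prob (cond_graph_pmf \<kappa> n x)
      ({G. (i, k) \<notin> (parcs G)\<^sup>*} \<union> {G. (k, j) \<notin> (parcs G)\<^sup>*})"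
    unfolding separation_def by (intro measure_pmf.finite_measure_mono) (auto intro: rtrancl_trans)
  also have "\<dots> \<le> separation n i k x + separation n k j x"
    unfolding separation_def by (intro measure_Un_le) auto
  finally show ?thesis .
qed

lemma integrable_points:
  fixes f :: "(nat \<Rightarrow> 'a) \<Rightarrow> real"
  assumes "f \<in> borel_measurable (points n)" "\<And>x. \<bar>f x\<bar> \<le> B"
  shows "integrable (points n) f"
proof -
  interpret I: prob_space "points n" by (rule prob_space_points)
  show ?thesis
    by (rule I.integrable_const_bound[where B=B]) (use assms in auto)
qed

text \<open>Values in the unit interval make all integrability claims and second moments trivial,
  and composition over a probability space preserves them.\<close>

definition unit_kernel :: "('a \<Rightarrow> 'a \<Rightarrow> real) \<Rightarrow> bool" where
  "unit_kernel h \<longleftrightarrow> (\<lambda>(x, y). h x y) \<in> borel_measurable (M \<Otimes>\<^sub>M M) \<and> (\<forall>x y. 0 \<le> h x y \<and> h x y \<le> 1)"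

lemma unit_kernel_measurable:
  assumes "unit_kernel h" "f \<in> N \<rightarrow>\<^sub>M M" "g \<in> N \<rightarrow>\<^sub>M M"
  shows "(\<lambda>x. h (f x) (g x)) \<in> borel_measurable N"
  using measurable_compose[OF measurable_Pair[OF assms(2,3)], of "\<lambda>(x, y). h x y"] assms(1)
  by (simp add: unit_kernel_def)

lemma unit_kernel_bounds:
  assumes "unit_kernel h"
  shows "0 \<le> h x y" "h x y \<le> 1" "\<bar>h x y\<bar> \<le> 1"
  using assms by (auto simp: unit_kernel_def)

definition compose :: "('a \<Rightarrow> 'a \<Rightarrow> real) \<Rightarrow> ('a \<Rightarrow> 'a \<Rightarrow> real) \<Rightarrow> 'a \<Rightarrow> 'a \<Rightarrow> real" where
  "compose h k x y = (\<integral>z. h x z * k z y \<partial>M)"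

lemma product_unit_bounds:
  assumes "unit_kernel h" "unit_kernel k"
  shows "0 \<le> h x z * k z' y" "h x z * k z' y \<le> 1" "\<bar>h x z * k z' y\<bar> \<le> 1"
  using assms by (auto simp: unit_kernel_def abs_mult intro: mult_le_one)

lemma compose_integrable:
  assumes "unit_kernel h" "unit_kernel k"
  shows "integrable M (\<lambda>z. h x z * k z y)"
  by (rule integrable_const_bound[where B=1])
    (use assms product_unit_bounds in \<open>auto intro!: borel_measurable_times unit_kernel_measurable[OF assms(1)]
        unit_kernel_measurable[OF assms(2)]\<close>)

lemma unit_kernel_compose:
  assumes h: "unit_kernel h" and k: "unit_kernel k"
  shows "unit_kernel (compose h k)"
  unfolding unit_kernel_def
proof (intro conjI allI)
  have [measurable]: "(\<lambda>w. h (fst (fst w)) (snd w) * k (snd w) (snd (fst w))) \<in> borel_measurable ((M \<Otimes>\<^sub>M M) \<Otimes>\<^sub>M M)"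
    by (intro borel_measurable_times unit_kernel_measurable[OF h] unit_kernel_measurable[OF k]) measurable
  have "(\<lambda>w. \<integral>z. h (fst w) z * k z (snd w) \<partial>M) \<in> borel_measurable (M \<Otimes>\<^sub>M M)"
    by (rule borel_measurable_lebesgue_integral) (simp add: case_prod_beta)
  then show "(\<lambda>(x, y). compose h k x y) \<in> borel_measurable (M \<Otimes>\<^sub>M M)"
    by (simp add: compose_def case_prod_beta')
  fix x y
  show "0 \<le> compose h k x y" "compose h k x y \<le> 1"
    unfolding compose_def
    by (auto intro!: integral_nonneg_AE integral_le_const compose_integrable assms
        product_unit_bounds[OF h k])
qed

section \<open>Law of large numbers for compositions of kernels\<close>

definition deviation ::
  "('a \<Rightarrow> 'a \<Rightarrow> real) \<Rightarrow> ('a \<Rightarrow> 'a \<Rightarrow> real) \<Rightarrow> nat \<Rightarrow> nat \<Rightarrow> nat \<Rightarrow> (nat \<Rightarrow> 'a) \<Rightarrow> real" where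
  "deviation h k i j z x = compose h k (x i) (x j) - h (x i) (x z) * k (x z) (x j)"

lemma deviation_bounded:
  assumes h: "unit_kernel h" and k: "unit_kernel k"
  shows "\<bar>deviation h k i j z x\<bar> \<le> 1" "\<bar>deviation h k i j z x * deviation h k i j w x\<bar> \<le> 1"
proof -
  show *: "\<bar>deviation h k i j z x\<bar> \<le> 1" for z
    using unit_kernel_bounds[OF unit_kernel_compose[OF h k], of "x i" "x j"]
      product_unit_bounds[OF h k, of "x i" "x z" "x z" "x j"]
    unfolding deviation_def by linarith
  show "\<bar>deviation h k i j z x * deviation h k i j w x\<bar> \<le> 1"
    using * by (simp add: abs_mult mult_le_one)
qed

lemma deviation_measurable:
  assumes h: "unit_kernel h" and k: "unit_kernel k" and "i \<in> {1..n}" "j \<in> {1..n}" "z \<in> {1..n}"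
  shows "deviation h k i j z \<in> borel_measurable (points n)"
  unfolding deviation_def[abs_def] using assms(3-)
  by (intro borel_measurable_diff borel_measurable_times unit_kernel_measurable[OF h] unit_kernel_measurable[OF k]
      unit_kernel_measurable[OF unit_kernel_compose[OF h k]] measurable_component_singleton)

lemma deviation_integrable:
  assumes "unit_kernel h" "unit_kernel k" "i \<in> {1..n}" "j \<in> {1..n}" "z \<in> {1..n}" "w \<in> {1..n}"
  shows "integrable (points n) (\<lambda>x. deviation h k i j z x * deviation h k i j w x)"
  using assms
  by (intro integrable_points[where B=1] borel_measurable_times deviation_measurable deviation_bounded(2))

text \<open>Integrate the point of \<open>w\<close> first. Since \<open>w\<close> differs from
  \<open>i\<close>, \<open>j\<close> and \<open>z\<close>, the other factor is constant, and the
  integral of the remaining one vanishes by the definition of \<open>compose\<close>.\<close>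

lemma deviation_orthogonal:
  assumes h: "unit_kernel h" and k: "unit_kernel k"
    and ind: "i \<in> {1..n}" "j \<in> {1..n}" "z \<in> {1..n}" "w \<in> {1..n}" and w: "w \<notin> {i, j, z}"
  shows "(\<integral>x. deviation h k i j z x * deviation h k i j w x \<partial>points n) = 0"
proof -
  let ?I = "{1..n} - {w}"
  let ?Y = "deviation h k i j"
  have ins: "insert w ?I = {1..n}" using ind by auto
  have int: "integrable (\<Pi>\<^sub>M i\<in>insert w ?I. M) (\<lambda>x. ?Y z x * ?Y w x)"
    unfolding ins by (rule deviation_integrable[OF h k ind])
  have cancel: "(\<integral>y. compose h k (x i) (x j) - h (x i) y * k y (x j) \<partial>M) = 0" for x :: "nat \<Rightarrow> 'a"
    by (subst Bochner_Integration.integral_diff)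
      (auto intro: compose_integrable[OF h k] simp: compose_def prob_space)
  have "(\<integral>x. ?Y z x * ?Y w x \<partial>points n) = (\<integral>x. (\<integral>y. ?Y z (x(w := y)) * ?Y w (x(w := y)) \<partial>M) \<partial>(\<Pi>\<^sub>M i\<in>?I. M))"
    by (subst ins[symmetric], rule P.product_integral_insert[OF _ _ int]) auto
  also have "\<dots> = (\<integral>x. (\<integral>y. ?Y z x * (compose h k (x i) (x j) - h (x i) y * k y (x j)) \<partial>M) \<partial>(\<Pi>\<^sub>M i\<in>?I. M))"
    using w by (simp add: deviation_def)
  also have "\<dots> = (\<integral>x. ?Y z x * (\<integral>y. compose h k (x i) (x j) - h (x i) y * k y (x j) \<partial>M) \<partial>(\<Pi>\<^sub>M i\<in>?I. M))"
    by simp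
  also have "\<dots> = 0"
    by (simp only: cancel) simp
  finally show ?thesis .
qed

text \<open>In the second moment of the average deviation nearly all mixed terms vanish by
  orthogonality, which leaves at most \<open>3 / n\<close>; the first moment follows by an AM-GM
  bound.\<close>

lemma expected_deviation_le:
  assumes h: "unit_kernel h" and k: "unit_kernel k"
    and ind: "i \<in> {1..n}" "j \<in> {1..n}"
  shows "(\<integral>x. \<bar>compose h k (x i) (x j) - (\<Sum>z\<in>{1..n}. h (x i) (x z) * k (x z) (x j)) / n\<bar> \<partial>points n)
    \<le> 2 / sqrt n"
proof -
  interpret I: prob_space "points n" by (rule prob_space_points)
  have n: "0 < n" using ind by auto
  let ?Y = "deviation h k i j"
  define D where "D x = (\<Sum>z\<in>{1..n}. ?Y z x) / n" for x
  have D: "D x = compose h k (x i) (x j) - (\<Sum>z\<in>{1..n}. h (x i) (x z) * k (x z) (x j)) / n" for x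
    using n by (simp add: D_def deviation_def sum_subtractf diff_divide_distrib)
  have Dm: "D \<in> borel_measurable (points n)"
    unfolding D_def by (intro borel_measurable_divide borel_measurable_sum deviation_measurable h k ind) auto
  have D1: "\<bar>D x\<bar> \<le> 1" for x
  proof -
    have "\<bar>\<Sum>z\<in>{1..n}. ?Y z x\<bar> \<le> (\<Sum>z\<in>{1..n}. 1)"
      by (intro order.trans[OF sum_abs] sum_mono deviation_bounded h k)
    then show ?thesis using n by (simp add: D_def)
  qed
  have D2int: "integrable (points n) (\<lambda>x. (D x)\<^sup>2)"
    using Dm D1 by (intro integrable_points[where B=1]) (auto simp: abs_square_le_1)
  have YY: "(\<integral>x. ?Y z x * ?Y w x \<partial>points n) \<le> of_bool (w \<in> {i, j, z})" if "z \<in> {1..n}" "w \<in> {1..n}" for z w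
  proof (cases "w \<in> {i, j, z}")
    case True
    have "(\<integral>x. ?Y z x * ?Y w x \<partial>points n) \<le> 1"
    proof (rule I.integral_le_const[OF deviation_integrable[OF h k ind that] AE_I2])
      show "?Y z x * ?Y w x \<le> 1" for x
        by (rule abs_le_D1) (rule deviation_bounded(2)[OF h k])
    qed
    then show ?thesis using True by simp
  next
    case False
    then show ?thesis
      using deviation_orthogonal[OF h k ind that] by simp
  qed
  have "(\<integral>x. (D x)\<^sup>2 \<partial>points n) = (\<integral>x. (\<Sum>z\<in>{1..n}. \<Sum>w\<in>{1..n}. ?Y z x * ?Y w x) / n\<^sup>2 \<partial>points n)"
    by (simp add: D_def power_divide power2_eq_square sum_product)
  also have "\<dots> = (\<Sum>z\<in>{1..n}. \<Sum>w\<in>{1..n}. (\<integral>x. ?Y z x * ?Y w x \<partial>points n)) / n\<^sup>2"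
  proof -
    note int = deviation_integrable[OF h k ind]
    have "(\<integral>x. (\<Sum>z\<in>{1..n}. \<Sum>w\<in>{1..n}. ?Y z x * ?Y w x) \<partial>points n) =
        (\<Sum>z\<in>{1..n}. \<integral>x. (\<Sum>w\<in>{1..n}. ?Y z x * ?Y w x) \<partial>points n)"
      by (intro Bochner_Integration.integral_sum Bochner_Integration.integrable_sum int)
    also have "\<dots> = (\<Sum>z\<in>{1..n}. \<Sum>w\<in>{1..n}. \<integral>x. ?Y z x * ?Y w x \<partial>points n)"
      by (intro sum.cong refl Bochner_Integration.integral_sum int)
    finally show ?thesis by simp
  qed
  also have "\<dots> \<le> (\<Sum>z\<in>{1..n}. \<Sum>w\<in>{1..n}. of_bool (w \<in> {i, j, z})) / n\<^sup>2"
    by (intro divide_right_mono sum_mono YY) auto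
  \<comment> \<open>For each \<open>z\<close> only \<open>w\<close> in \<open>{i, j, z}\<close> can
    contribute, at most 1 each.\<close>
  also have "\<dots> \<le> (\<Sum>z\<in>{1..n}. 3) / n\<^sup>2"
  proof (intro divide_right_mono sum_mono)
    fix z
    have "(\<Sum>w\<in>{1..n}. of_bool (w \<in> {i, j, z})) = (card ({1..n} \<inter> {i, j, z}) :: real)"
      by (simp add: of_bool_def sum.If_cases Int_def)
    also have "card ({1..n} \<inter> {i, j, z}) \<le> card {i, j, z}"
      by (intro card_mono) auto
    also have "card {i, j, z} \<le> 3"
      by (simp add: card_insert_if)
    finally show "(\<Sum>w\<in>{1..n}. of_bool (w \<in> {i, j, z})) \<le> (3 :: real)"
      by simp
  qed auto
  also have "\<dots> = 3 / n"
    using n by (simp add: power2_eq_square)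
  finally have var: "(\<integral>x. (D x)\<^sup>2 \<partial>points n) \<le> 3 / n" .
  \<comment> \<open>The weights balance the two terms: with \<open>var\<close> the right-hand side
    integrates to at most \<open>(1 + 3) / (2 * sqrt n)\<close>.\<close>
  have amgm: "\<bar>D x\<bar> \<le> (1 / sqrt n + sqrt n * (D x)\<^sup>2) / 2" for x
  proof -
    have "0 \<le> (1 - sqrt n * \<bar>D x\<bar>)\<^sup>2" by simp
    also have "\<dots> = 1 - 2 * (sqrt n * \<bar>D x\<bar>) + n * (D x)\<^sup>2"
      by (simp add: power2_diff power_mult_distrib)
    also have "real n * (D x)\<^sup>2 = sqrt n * (sqrt n * (D x)\<^sup>2)"
      by (simp flip: mult.assoc)
    finally show ?thesis using n by (simp add: field_simps)
  qed
  have "(\<integral>x. \<bar>D x\<bar> \<partial>points n) \<le> (\<integral>x. (1 / sqrt n + sqrt n * (D x)\<^sup>2) / 2 \<partial>points n)"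
    using Dm D1 by (intro integral_mono amgm integrable_abs integrable_points[where B=1] integrable_divide
        Bochner_Integration.integrable_add I.integrable_const integrable_mult_right D2int) auto
  also have "\<dots> = (1 / sqrt n + sqrt n * (\<integral>x. (D x)\<^sup>2 \<partial>points n)) / 2"
    using D2int by (simp add: I.prob_space del: One_nat_def)
  also have "\<dots> \<le> (1 / sqrt n + sqrt n * (3 / n)) / 2"
    using var by (intro divide_right_mono add_left_mono mult_left_mono) auto
  also have "\<dots> = 2 / sqrt n"
    using n by (simp add: field_simps)
  finally show ?thesis
    unfolding D .
qed

end

section \<open>Separated mass of the truncated kernel and of compositions\<close>

lemma sum_symmetric_pairs:
  fixes f :: "nat \<Rightarrow> nat \<Rightarrow> real"
  assumes "\<And>i j. f i j = f j i" "\<And>i. f i i = 0"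
  shows "(\<Sum>i\<in>{1..n}. \<Sum>j\<in>{1..n}. f i j) = 2 * (\<Sum>(i, j)\<in>vertex_pairs n. f i j)"
proof -
  let ?V = "vertex_pairs n" and ?D = "(\<lambda>i. (i, i)) ` {1..n}"
  have un: "{1..n} \<times> {1..n} = (?V \<union> prod.swap ` ?V) \<union> ?D"
    by (auto simp: vertex_pairs_def image_iff)
  have "(\<Sum>i\<in>{1..n}. \<Sum>j\<in>{1..n}. f i j) = (\<Sum>(i, j)\<in>{1..n} \<times> {1..n}. f i j)"
    by (rule sum.cartesian_product)
  also have "\<dots> = (\<Sum>(i, j)\<in>?V. f i j) + (\<Sum>(i, j)\<in>prod.swap ` ?V. f i j) + (\<Sum>(i, j)\<in>?D. f i j)"
    unfolding un by (subst sum.union_disjoint, simp, simp, force simp: vertex_pairs_def)+ simp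
  also have "(\<Sum>(i, j)\<in>?D. f i j) = 0"
    using assms(2) by (intro sum.neutral) auto
  also have "(\<Sum>(i, j)\<in>prod.swap ` ?V. f i j) = (\<Sum>(i, j)\<in>?V. f i j)"
    by (subst sum.reindex) (auto simp: assms(1) intro!: sum.cong)
  finally show ?thesis by simp
qed

context regular_kernel
begin

definition separated_mass :: "('a \<Rightarrow> 'a \<Rightarrow> real) \<Rightarrow> nat \<Rightarrow> real" where
  "separated_mass h n = (\<Sum>i\<in>{1..n}. \<Sum>j\<in>{1..n}. \<integral>x. h (x i) (x j) * separation n i j x \<partial>points n) / (real n)\<^sup>2"

lemma separated_integrable:
  assumes "unit_kernel h" "a \<in> {1..n}" "b \<in> {1..n}"
  shows "integrable (points n) (\<lambda>x. h (x a) (x b) * separation n i j x)"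
  using assms unit_kernel_bounds[OF assms(1)] separation_bounds
  by (intro integrable_points[where B=1] borel_measurable_times separation_measurable
      unit_kernel_measurable[OF assms(1)] measurable_component_singleton)
    (auto simp: abs_mult intro: mult_le_one)

lemma separated_mass_nonneg:
  assumes "unit_kernel h"
  shows "0 \<le> separated_mass h n"
  unfolding separated_mass_def using unit_kernel_bounds[OF assms] separation_bounds
  by (intro divide_nonneg_nonneg sum_nonneg integral_nonneg_AE) auto

lemma unit_kernel_min: "unit_kernel (\<lambda>x y. min 1 (\<kappa> x y))"
  using kernel_nonneg kernel_measurable' by (auto simp: unit_kernel_def case_prod_beta')

text \<open>Since \<open>?p \<le> 1\<close>, the truncated kernel times \<open>?p\<close> is at most
  the edge probability, and the merging bound gives at most \<open>n / ?p\<close> over unordered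
  pairs. The factor 2 comes from counting ordered pairs.\<close>

lemma separated_mass_min:
  assumes n: "2 \<le> n"
  shows "separated_mass (\<lambda>x y. min 1 (\<kappa> x y)) n \<le> 2 / ln n"
proof -
  interpret I: prob_space "points n" by (rule prob_space_points)
  let ?h = "\<lambda>x y. min 1 (\<kappa> x y)" and ?p = "ln (real n) / n"
  let ?f = "\<lambda>i j. \<integral>x. ?h (x i) (x j) * separation n i j x \<partial>points n"
  have p: "0 < ?p" "?p \<le> 1"
    using n ln_le_minus_one[of n] by (auto simp: field_simps)
  have le: "(\<Sum>(i, j)\<in>vertex_pairs n. ?h (x i) (x j) * separation n i j x) \<le> n / ?p" for x
  proof -
    have "(\<Sum>(i, j)\<in>vertex_pairs n. ?h (x i) (x j) * separation n i j x) * ?p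
        = (\<Sum>(i, j)\<in>vertex_pairs n. (?h (x i) (x j) * ?p) * separation n i j x)"
      unfolding sum_distrib_right by (intro sum.cong) auto
    also have "\<dots> \<le> (\<Sum>(i, j)\<in>vertex_pairs n. edge_prob \<kappa> n x (i, j) * separation n i j x)"
    proof (intro sum_mono, clarify)
      fix i j
      have "?h (x i) (x j) * ?p \<le> 1 * ?p" "?h (x i) (x j) * ?p \<le> \<kappa> (x i) (x j) * ?p"
        using p by (intro mult_right_mono; simp)+
      then have "?h (x i) (x j) * ?p \<le> edge_prob \<kappa> n x (i, j)"
        unfolding edge_prob_def using p(2) by simp
      then show "?h (x i) (x j) * ?p * separation n i j x \<le> edge_prob \<kappa> n x (i, j) * separation n i j x"
        by (intro mult_right_mono separation_bounds)
    qed
    also have "\<dots> \<le> n"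
      using sum_edge_prob_separated_le[OF kernel_nonneg, where n=n and x=x] by (simp add: separation_def case_prod_beta')
    finally show ?thesis
      by (simp only: pos_le_divide_eq[OF p(1)])
  qed
  have "(\<Sum>i\<in>{1..n}. \<Sum>j\<in>{1..n}. ?f i j) = 2 * (\<Sum>(i, j)\<in>vertex_pairs n. ?f i j)"
    by (rule sum_symmetric_pairs) (simp_all add: kernel_sym separation_commute)
  also have "(\<Sum>(i, j)\<in>vertex_pairs n. ?f i j) =
      (\<integral>x. (\<Sum>(i, j)\<in>vertex_pairs n. ?h (x i) (x j) * separation n i j x) \<partial>points n)"
    by (subst Bochner_Integration.integral_sum)
      (auto simp: vertex_pairs_def case_prod_beta' simp del: One_nat_def intro!: separated_integrable[OF unit_kernel_min])
  also have "\<dots> \<le> n / ?p"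
    by (intro I.integral_le_const AE_I2 le Bochner_Integration.integrable_sum)
      (auto simp: vertex_pairs_def simp del: One_nat_def intro!: separated_integrable[OF unit_kernel_min])
  finally have "separated_mass ?h n \<le> (2 * (n / ?p)) / (real n)\<^sup>2"
    unfolding separated_mass_def by (intro divide_right_mono) auto
  also have "\<dots> = 2 / ln n"
    using n by (simp add: power2_eq_square)
  finally show ?thesis .
qed

text \<open>Replace the composition by its empirical average over intermediate vertices
  \<open>z\<close>, at cost \<open>2 / sqrt n\<close>. If \<open>i\<close> and \<open>j\<close> are
  separated, then \<open>z\<close> is separated from one of them, which charges the term to
  \<open>h\<close> or to \<open>k\<close>.\<close>

lemma separated_mass_compose:
  assumes h: "unit_kernel h" and k: "unit_kernel k"
  shows "separated_mass (compose h k) n \<le> separated_mass h n + separated_mass k n + 2 / sqrt n"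
proof (cases "n = 0")
  case False
  then have n: "0 < n" by simp
  note hk = unit_kernel_compose[OF h k]
  let ?D = "\<lambda>i j x. \<bar>compose h k (x i) (x j) - (\<Sum>z\<in>{1..n}. h (x i) (x z) * k (x z) (x j)) / n\<bar>"
  let ?H = "\<lambda>i j. \<integral>x. h (x i) (x j) * separation n i j x \<partial>points n"
  let ?K = "\<lambda>i j. \<integral>x. k (x i) (x j) * separation n i j x \<partial>points n"
  have Dint: "integrable (points n) (?D i j)" if "i \<in> {1..n}" "j \<in> {1..n}" for i j
  proof (rule integrable_points[where B="1 + (\<Sum>z\<in>{1..n}. 1) / n"])
    show "?D i j \<in> borel_measurable (points n)"
      using that by (intro borel_measurable_abs borel_measurable_diff borel_measurable_divide borel_measurable_sum
          borel_measurable_times unit_kernel_measurable[OF hk] unit_kernel_measurable[OF h]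
          unit_kernel_measurable[OF k] measurable_component_singleton) auto
    fix x
    have "\<bar>(\<Sum>z\<in>{1..n}. h (x i) (x z) * k (x z) (x j)) / n\<bar> \<le> (\<Sum>z\<in>{1..n}. 1) / n"
      unfolding abs_divide
      by (intro frac_le order.trans[OF sum_abs] sum_mono product_unit_bounds[OF h k]) (use n in auto)
    then show "\<bar>?D i j x\<bar> \<le> 1 + (\<Sum>z\<in>{1..n}. 1) / n"
      using unit_kernel_bounds[OF hk, of "x i" "x j"] by linarith
  qed
  have pair: "(\<integral>x. compose h k (x i) (x j) * separation n i j x \<partial>points n)
      \<le> 2 / sqrt n + (\<Sum>z\<in>{1..n}. ?H i z + ?K z j) / n" if ij: "i \<in> {1..n}" "j \<in> {1..n}" for i j
  proof -
    let ?R = "\<lambda>x. \<Sum>z\<in>{1..n}. h (x i) (x z) * separation n i z x + k (x z) (x j) * separation n z j x"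
    have Rint: "integrable (points n) ?R"
      using ij by (intro Bochner_Integration.integrable_sum Bochner_Integration.integrable_add
          separated_integrable[OF h] separated_integrable[OF k])
    have "(\<integral>x. compose h k (x i) (x j) * separation n i j x \<partial>points n) \<le> (\<integral>x. ?D i j x + ?R x / n \<partial>points n)"
    proof (intro integral_mono Bochner_Integration.integrable_add Dint integrable_divide Rint separated_integrable[OF hk] ij)
      fix x
      let ?s = "separation n i j x"
      let ?A = "(\<Sum>z\<in>{1..n}. h (x i) (x z) * k (x z) (x j)) / n"
      have "compose h k (x i) (x j) * ?s \<le> (?A + ?D i j x) * ?s"
        using separation_bounds by (intro mult_right_mono) auto
      \<comment> \<open>The replacement error is kept without the factor \<open>?s \<le> 1\<close>,
        so that only its mean is needed.\<close>
      also have "\<dots> \<le> ?A * ?s + ?D i j x"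
        using mult_left_le[of ?s "?D i j x"] separation_bounds by (simp add: distrib_right)
      also have "?A * ?s = (\<Sum>z\<in>{1..n}. h (x i) (x z) * k (x z) (x j) * ?s) / n"
        by (simp add: sum_distrib_right)
      also have "\<dots> \<le> ?R x / n"
      proof (intro divide_right_mono sum_mono)
        fix z
        let ?a = "h (x i) (x z)" and ?b = "k (x z) (x j)"
        have "?a * ?b * ?s \<le> ?a * ?b * (separation n i z x + separation n z j x)"
          by (intro mult_left_mono separation_triangle product_unit_bounds[OF h k])
        also have "\<dots> = ?b * (?a * separation n i z x) + ?a * (?b * separation n z j x)"
          by (simp add: algebra_simps)
        \<comment> \<open>In each summand the kernel value that is not tied to the separated pair is
          bounded by 1.\<close>
        also have "\<dots> \<le> 1 * (?a * separation n i z x) + 1 * (?b * separation n z j x)"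
          using separation_bounds unit_kernel_bounds[OF h] unit_kernel_bounds[OF k]
          by (intro add_mono mult_right_mono mult_nonneg_nonneg) auto
        finally show "?a * ?b * ?s \<le> ?a * separation n i z x + ?b * separation n z j x" by simp
      qed simp
      finally show "compose h k (x i) (x j) * ?s \<le> ?D i j x + ?R x / n" by simp
    qed
    also have "\<dots> = (\<integral>x. ?D i j x \<partial>points n) + (\<integral>x. ?R x / n \<partial>points n)"
      by (intro Bochner_Integration.integral_add Dint ij integrable_divide Rint)
    also have "(\<integral>x. ?R x / n \<partial>points n) = (\<Sum>z\<in>{1..n}. ?H i z + ?K z j) / n"
    proof -
      have "(\<integral>x. ?R x \<partial>points n) = (\<Sum>z\<in>{1..n}. \<integral>x. h (x i) (x z) * separation n i z x + k (x z) (x j) * separation n z j x \<partial>points n)"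
        using ij by (intro Bochner_Integration.integral_sum Bochner_Integration.integrable_add
            separated_integrable[OF h] separated_integrable[OF k])
      also have "\<dots> = (\<Sum>z\<in>{1..n}. ?H i z + ?K z j)"
        using ij by (intro sum.cong refl Bochner_Integration.integral_add
            separated_integrable[OF h] separated_integrable[OF k])
      finally show ?thesis by simp
    qed
    finally show ?thesis
      using expected_deviation_le[OF h k ij] by linarith
  qed
  have "(\<Sum>i\<in>{1..n}. \<Sum>j\<in>{1..n}. \<integral>x. compose h k (x i) (x j) * separation n i j x \<partial>points n)
      \<le> (\<Sum>i\<in>{1..n}. \<Sum>j\<in>{1..n}. 2 / sqrt n + (\<Sum>z\<in>{1..n}. ?H i z + ?K z j) / n)"
    by (intro sum_mono pair)
  also have "\<dots> = n * (n * (2 / sqrt n)) + ((\<Sum>i\<in>{1..n}. \<Sum>j\<in>{1..n}. \<Sum>z\<in>{1..n}. ?H i z)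
      + (\<Sum>i\<in>{1..n}. \<Sum>j\<in>{1..n}. \<Sum>z\<in>{1..n}. ?K z j)) / n"
    by (simp only: sum.distrib sum_divide_distrib[symmetric] add_divide_distrib) simp
  \<comment> \<open>The free index yields a factor \<open>n\<close>, which cancels the
    \<open>1 / n\<close> of the empirical average.\<close>
  also have "(\<Sum>i\<in>{1..n}. \<Sum>j\<in>{1..n}. \<Sum>z\<in>{1..n}. ?H i z) = n * (\<Sum>i\<in>{1..n}. \<Sum>z\<in>{1..n}. ?H i z)"
    by (subst sum.swap) simp
  also have "(\<Sum>i\<in>{1..n}. \<Sum>j\<in>{1..n}. \<Sum>z\<in>{1..n}. ?K z j) = n * (\<Sum>z\<in>{1..n}. \<Sum>j\<in>{1..n}. ?K z j)"
    using sum.swap[of "\<lambda>j z. ?K z j" "{1..n}" "{1..n}"] by simp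
  finally have "separated_mass (compose h k) n \<le> (n * (n * (2 / sqrt n)) + (n * (\<Sum>i\<in>{1..n}. \<Sum>z\<in>{1..n}. ?H i z)
      + n * (\<Sum>z\<in>{1..n}. \<Sum>j\<in>{1..n}. ?K z j)) / n) / (real n)\<^sup>2"
    unfolding separated_mass_def by (intro divide_right_mono) auto
  also have "\<dots> = separated_mass h n + separated_mass k n + 2 / sqrt n"
    using n unfolding separated_mass_def by (simp add: add_divide_distrib power2_eq_square del: times_divide_eq_right)
  finally show ?thesis .
qed (simp add: separated_mass_def)

end

section \<open>Irreducibility\<close>

context regular_kernel
begin

lemma tendsto_separated_mass_min: "separated_mass (\<lambda>x y. min 1 (\<kappa> x y)) \<longlonglongrightarrow> 0"
proof (rule tendsto_sandwich)
  show "\<forall>\<^sub>F n in sequentially. 0 \<le> separated_mass (\<lambda>x y. min 1 (\<kappa> x y)) n"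
    by (intro always_eventually allI separated_mass_nonneg unit_kernel_min)
  show "\<forall>\<^sub>F n in sequentially. separated_mass (\<lambda>x y. min 1 (\<kappa> x y)) n \<le> 2 / ln (real n)"
    using eventually_ge_at_top[of 2] by eventually_elim (rule separated_mass_min)
  show "(\<lambda>n. 2 / ln (real n)) \<longlonglongrightarrow> 0"
    by real_asymp
qed simp

lemma tendsto_separated_mass_compose:
  assumes h: "unit_kernel h" "separated_mass h \<longlonglongrightarrow> 0" and k: "unit_kernel k" "separated_mass k \<longlonglongrightarrow> 0"
  shows "separated_mass (compose h k) \<longlonglongrightarrow> 0"
proof (rule tendsto_sandwich)
  show "\<forall>\<^sub>F n in sequentially. 0 \<le> separated_mass (compose h k) n"
    by (intro always_eventually allI separated_mass_nonneg unit_kernel_compose h k)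
  show "\<forall>\<^sub>F n in sequentially. separated_mass (compose h k) n
      \<le> separated_mass h n + separated_mass k n + 2 / sqrt n"
    by (intro always_eventually allI separated_mass_compose h k)
  have "(\<lambda>n. 2 / sqrt (real n)) \<longlonglongrightarrow> 0"
    by real_asymp
  then show "(\<lambda>n. separated_mass h n + separated_mass k n + 2 / sqrt n) \<longlonglongrightarrow> 0"
    using tendsto_add_zero[OF tendsto_add_zero[OF h(2) k(2)]] by simp
qed simp

text \<open>\<open>iterate m\<close> has \<open>m + 1\<close> kernel factors: it weighs paths of
  \<open>m + 1\<close> steps between the two points.\<close>

fun iterate :: "nat \<Rightarrow> 'a \<Rightarrow> 'a \<Rightarrow> real" where
  "iterate 0 = (\<lambda>x y. min 1 (\<kappa> x y))"
| "iterate (Suc m) = compose (iterate m) (\<lambda>x y. min 1 (\<kappa> x y))"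

lemma unit_kernel_iterate: "unit_kernel (iterate m)"
  by (induction m) (simp_all add: unit_kernel_min unit_kernel_compose)

lemma tendsto_separated_mass_iterate: "separated_mass (iterate m) \<longlonglongrightarrow> 0"
  by (induction m)
    (simp_all add: tendsto_separated_mass_min tendsto_separated_mass_compose unit_kernel_min unit_kernel_iterate)

text \<open>Let \<open>?B\<close> be the set of points unreachable from \<open>x\<close>. The kernel
  vanishes between \<open>?B\<close> and its complement, for otherwise one more step would reach
  \<open>?B\<close>. Irreducibility then makes \<open>?B\<close> null or of full measure.\<close>

lemma AE_iterate_pos:
  assumes irr: "\<not> reducible_kernel M \<kappa>" and deg: "0 < deg"
  shows "AE y in M. \<exists>m. 0 < iterate m x y"
proof -
  let ?B = "{y. \<forall>m. iterate m x y = 0}"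
  interpret MM: pair_sigma_finite M M ..
  have [measurable]: "(\<lambda>y. iterate m x y) \<in> borel_measurable M" for m
    by (intro unit_kernel_measurable[OF unit_kernel_iterate]) measurable
  have iterate_nonneg: "0 \<le> iterate m x y" for m x y
    by (rule unit_kernel_bounds(1)[OF unit_kernel_iterate])
  have B [measurable]: "?B \<in> sets M"
  proof -
    have "{y \<in> space M. \<forall>m. iterate m x y = 0} \<in> sets M" by measurable
    then show ?thesis by (simp add: space_UNIV)
  qed
  have "AE y in M. y \<notin> ?B \<longrightarrow> \<kappa> z y = 0" if z: "z \<in> ?B" for z
  proof -
    have "AE y in M. iterate m x y * min 1 (\<kappa> y z) = 0" for m
    proof (subst integral_nonneg_eq_0_iff_AE[symmetric])
      show "integrable M (\<lambda>y. iterate m x y * min 1 (\<kappa> y z))"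
        by (rule compose_integrable[OF unit_kernel_iterate unit_kernel_min])
      show "AE y in M. 0 \<le> iterate m x y * min 1 (\<kappa> y z)"
        using iterate_nonneg kernel_nonneg by auto
      have "iterate (Suc m) x z = 0"
        using z by blast
      then show "(\<integral>y. iterate m x y * min 1 (\<kappa> y z) \<partial>M) = 0"
        by (simp add: compose_def)
    qed
    \<comment> \<open>The countably many null sets are merged. For \<open>y\<close> outside
      \<open>?B\<close> some iterate is positive, which forces
      \<open>\<kappa> y z = 0\<close>.\<close>
    then have "AE y in M. \<forall>m. iterate m x y * min 1 (\<kappa> y z) = 0"
      unfolding AE_all_countable by blast
    then show ?thesis
      by eventually_elim (auto simp: kernel_sym[of z] min_def split: if_splits)
  qed
  then have "AE y in M. (z, y) \<in> ?B \<times> (space M - ?B) \<longrightarrow> \<kappa> z y = 0" for z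
    by (cases "z \<in> ?B") (force elim: eventually_mono)+
  then have *: "AE z in M. AE y in M. (z, y) \<in> ?B \<times> (space M - ?B) \<longrightarrow> \<kappa> z y = 0"
    by (rule AE_I2)
  have "AE (z, y) in M \<Otimes>\<^sub>M M. (z, y) \<in> ?B \<times> (space M - ?B) \<longrightarrow> \<kappa> z y = 0"
  proof -
    have "{w \<in> space (M \<Otimes>\<^sub>M M). w \<in> ?B \<times> (space M - ?B) \<longrightarrow> \<kappa> (fst w) (snd w) = 0} \<in> sets (M \<Otimes>\<^sub>M M)"
      using B by measurable
    then have "AE w in M \<Otimes>\<^sub>M M. w \<in> ?B \<times> (space M - ?B) \<longrightarrow> \<kappa> (fst w) (snd w) = 0"
      by (rule MM.AE_pair_measure) (use * in simp)
    then show ?thesis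
      by eventually_elim (auto split: prod.split)
  qed
  then have "measure M ?B = 0 \<or> measure M ?B = 1"
    using irr B prob_le_1[of ?B] measure_nonneg[of M ?B] unfolding reducible_kernel_def
    by (meson antisym_conv2 less_le not_le)
  \<comment> \<open>Full measure would make \<open>iterate 0 x\<close>, hence
    \<open>\<kappa> x\<close>, vanish almost everywhere, against \<open>deg > 0\<close>.\<close>
  moreover have "measure M ?B \<noteq> 1"
  proof
    assume "measure M ?B = 1"
    then have "AE y in M. y \<in> ?B"
      using B by (subst (asm) prob_eq_1) auto
    then have "AE y in M. \<kappa> x y = 0"
    proof eventually_elim
      case (elim y)
      then have "iterate 0 x y = 0" by blast
      then show ?case by (auto simp: min_def split: if_splits)
    qed
    then have "(\<integral>y. \<kappa> x y \<partial>M) = 0"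
      by (rule integral_eq_zero_AE)
    with deg show False by (simp add: integral_kernel)
  qed
  ultimately have "AE y in M. y \<notin> ?B"
    using B by (subst prob_eq_0[symmetric]) auto
  then show ?thesis
    by eventually_elim (use iterate_nonneg in \<open>auto simp: less_le\<close>)
qed

lemma integral_points_pair:
  fixes f :: "'a \<Rightarrow> 'a \<Rightarrow> real"
  assumes f: "unit_kernel f" and ij: "i \<in> {1..n}" "j \<in> {1..n}" "i \<noteq> j"
  shows "(\<integral>x. f (x i) (x j) \<partial>points n) = (\<integral>x. \<integral>y. f x y \<partial>M \<partial>M)"
proof -
  let ?I = "{1..n} - {j}"
  have ins: "insert j ?I = {1..n}" using ij by auto
  have int: "integrable (\<Pi>\<^sub>M i\<in>insert j ?I. M) (\<lambda>x. f (x i) (x j))"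
    unfolding ins using unit_kernel_bounds[OF f] ij
    by (intro integrable_points[where B=1] unit_kernel_measurable[OF f] measurable_component_singleton) auto
  have [measurable]: "(\<lambda>w. f (fst w) (snd w)) \<in> borel_measurable (M \<Otimes>\<^sub>M M)"
    by (intro unit_kernel_measurable[OF f]) measurable
  have meas: "(\<lambda>x. \<integral>y. f x y \<partial>M) \<in> borel_measurable M"
    by (rule borel_measurable_lebesgue_integral) (simp add: case_prod_beta)
  have "(\<integral>x. f (x i) (x j) \<partial>points n) = (\<integral>x. (\<integral>y. f ((x(j := y)) i) ((x(j := y)) j) \<partial>M) \<partial>(\<Pi>\<^sub>M i\<in>?I. M))"
    by (subst ins[symmetric], rule P.product_integral_insert[OF _ _ int]) auto
  also have "\<dots> = (\<integral>x. (\<integral>y. f (x i) y \<partial>M) \<partial>(\<Pi>\<^sub>M i\<in>?I. M))"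
    using ij by simp
  also have "\<dots> = (\<integral>x. \<integral>y. f x y \<partial>M \<partial>distr (\<Pi>\<^sub>M i\<in>?I. M) M (\<lambda>x. x i))"
    using ij by (intro integral_distr[symmetric] measurable_component_singleton meas) auto
  also have "distr (\<Pi>\<^sub>M i\<in>?I. M) M (\<lambda>x. x i) = M"
    using ij by (intro distr_PiM_component prob_space_axioms) auto
  finally show ?thesis .
qed

text \<open>Outside a set \<open>H N\<close> of small measure, the constant 1 is at most
  \<open>N + 1\<close> times the sum of the first \<open>N\<close> iterates, each of which has
  vanishing separated mass.\<close>

lemma tendsto_separated_mass_one:
  assumes irr: "\<not> reducible_kernel M \<kappa>" and deg: "0 < deg"
  shows "separated_mass (\<lambda>_ _. 1) \<longlonglongrightarrow> 0"
proof -
  interpret MM: pair_prob_space M M ..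
  define W where "W N x y = (\<Sum>m<N. iterate m x y)" for N x y
  \<comment> \<open>The threshold shrinks as \<open>N\<close> grows, so one index controls both it
    and the number of iterates, and the sets decrease.\<close>
  define H where "H N = {w. W N (fst w) (snd w) < 1 / (real N + 1)}" for N
  have it_nonneg: "0 \<le> iterate m x y" for m x y
    by (rule unit_kernel_bounds(1)[OF unit_kernel_iterate])
  have W_meas: "(\<lambda>w. W N (fst w) (snd w)) \<in> borel_measurable (M \<Otimes>\<^sub>M M)" for N
    unfolding W_def by (intro borel_measurable_sum unit_kernel_measurable[OF unit_kernel_iterate]) measurable
  have H_sets: "H N \<in> sets (M \<Otimes>\<^sub>M M)" for N
  proof -
    have "{w \<in> space (M \<Otimes>\<^sub>M M). W N (fst w) (snd w) < 1 / (real N + 1)} \<in> sets (M \<Otimes>\<^sub>M M)"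
      using W_meas by measurable
    then show ?thesis by (simp add: H_def space_pair_measure space_UNIV)
  qed
  have W_mono: "W N x y \<le> W N' x y" if "N \<le> N'" for N N' x y
    unfolding W_def using that it_nonneg by (intro sum_mono2) auto
  have H_anti: "decseq H"
  proof (rule antimonoI, clarsimp simp: H_def)
    fix N N' :: nat and a b assume NN: "N \<le> N'" and "W N' a b < 1 / (real N' + 1)"
    then have "W N a b < 1 / (real N' + 1)" using W_mono[OF NN, of a b] by simp
    also have "\<dots> \<le> 1 / (real N + 1)" using NN by (simp add: frac_le)
    finally show "W N a b < 1 / (real N + 1)" .
  qed
  have H_Int: "\<exists>m. 0 < iterate m (fst w) (snd w) \<Longrightarrow> w \<notin> (\<Inter>N. H N)" for w
  proof (erule exE, rule notI)
    fix m assume pos: "0 < iterate m (fst w) (snd w)" and w: "w \<in> (\<Inter>N. H N)"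
    obtain N where N: "1 / (real N + 1) < iterate m (fst w) (snd w)"
      using reals_Archimedean[OF pos] by (auto simp: inverse_eq_divide add.commute)
    \<comment> \<open>Large enough both to include the \<open>m\<close>-th iterate in the sum and to
      bring the threshold below its value.\<close>
    let ?N = "max N (Suc m)"
    have "iterate m (fst w) (snd w) \<le> W ?N (fst w) (snd w)"
      unfolding W_def using it_nonneg by (intro member_le_sum) auto
    also have "\<dots> < 1 / (real ?N + 1)" using w by (auto simp: H_def)
    also have "\<dots> \<le> 1 / (real N + 1)" by (simp add: frac_le)
    finally show False using N by simp
  qed
  have "AE w in M \<Otimes>\<^sub>M M. w \<notin> (\<Inter>N. H N)"
  proof -
    have m: "{w \<in> space (M \<Otimes>\<^sub>M M). w \<notin> (\<Inter>N. H N)} \<in> sets (M \<Otimes>\<^sub>M M)"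
      using H_sets by measurable
    have "AE x in M. AE y in M. (x, y) \<notin> (\<Inter>N. H N)"
    proof (rule AE_I2)
      fix x
      show "AE y in M. (x, y) \<notin> (\<Inter>N. H N)"
        using AE_iterate_pos[OF irr deg, of x] by eventually_elim (rule H_Int, simp)
    qed
    then show ?thesis
      using MM.AE_pair_measure[OF m] by simp
  qed
  then have "measure (M \<Otimes>\<^sub>M M) (\<Inter>N. H N) = 0"
    using H_sets by (subst MM.prob_eq_0) auto
  then have H_lim: "(\<lambda>N. measure (M \<Otimes>\<^sub>M M) (H N)) \<longlonglongrightarrow> 0"
    using MM.finite_Lim_measure_decseq[OF _ H_anti] H_sets by (metis image_subsetI)
  have bound: "separated_mass (\<lambda>_ _. 1) n \<le> (real N + 1) * (\<Sum>m<N. separated_mass (iterate m) n) + measure (M \<Otimes>\<^sub>M M) (H N)"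
    for n N
  proof (cases "n = 0")
    case False
    let ?H = "\<lambda>x y. indicator (H N) (x, y) :: real"
    have H: "unit_kernel ?H"
      using H_sets by (auto simp: unit_kernel_def case_prod_beta' indicator_def[abs_def])
    have Hint: "(\<integral>x. \<integral>y. ?H x y \<partial>M \<partial>M) = measure (M \<Otimes>\<^sub>M M) (H N)"
    proof -
      have "(\<integral>x. \<integral>y. ?H x y \<partial>M \<partial>M) = (\<integral>w. indicator (H N) w \<partial>(M \<Otimes>\<^sub>M M))"
        using H_sets by (intro MM.integral_fst') (auto intro!: integrable_real_indicator simp: MM.emeasure_eq_measure)
      then show ?thesis using H_sets by simp
    qed
    let ?S = "\<lambda>h i j. \<integral>x. h (x i) (x j) * separation n i j x \<partial>points n"
    have le: "?S (\<lambda>_ _. 1) i j \<le> (real N + 1) * (\<Sum>m<N. ?S (iterate m) i j) + measure (M \<Otimes>\<^sub>M M) (H N)"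
      if ij: "i \<in> {1..n}" "j \<in> {1..n}" for i j
    proof (cases "i = j")
      case True
      then show ?thesis by simp
    next
      case False
      have sepint: "integrable (points n) (separation n i j)"
        using separation_bounds
        by (intro integrable_points[where B=1] separation_measurable) (simp add: abs_of_nonneg)
      have Hxint: "integrable (points n) (\<lambda>x. ?H (x i) (x j))"
        by (intro integrable_points[where B=1] unit_kernel_measurable[OF H] measurable_component_singleton ij)
          (auto simp: indicator_def)
      have Wint: "integrable (points n) (\<lambda>x. (real N + 1) * (\<Sum>m<N. iterate m (x i) (x j) * separation n i j x))"
        by (intro integrable_mult_right Bochner_Integration.integrable_sum separated_integrable[OF unit_kernel_iterate] ij)
      have "(\<integral>x. 1 * separation n i j x \<partial>points n) \<le>
          (\<integral>x. (real N + 1) * (\<Sum>m<N. iterate m (x i) (x j) * separation n i j x) + ?H (x i) (x j) \<partial>points n)"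
      proof (intro integral_mono Bochner_Integration.integrable_add Wint Hxint)
        fix x
        let ?s = "separation n i j x"
        \<comment> \<open>On \<open>H N\<close> the indicator supplies the 1; elsewhere the weight
          is at least \<open>1 / (N + 1)\<close>.\<close>
        have "1 \<le> (real N + 1) * W N (x i) (x j) + ?H (x i) (x j)"
        proof (cases "(x i, x j) \<in> H N")
          case True
          then show ?thesis
            using W_mono[of 0 N "x i" "x j"] by (simp add: W_def)
        next
          case False
          then show ?thesis by (simp add: H_def not_less field_simps)
        qed
        then have "1 * ?s \<le> ((real N + 1) * W N (x i) (x j) + ?H (x i) (x j)) * ?s"
          by (intro mult_right_mono separation_bounds)
        also have "\<dots> = (real N + 1) * (\<Sum>m<N. iterate m (x i) (x j) * ?s) + ?H (x i) (x j) * ?s"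
          by (simp add: W_def algebra_simps sum_distrib_left)
        also have "\<dots> \<le> (real N + 1) * (\<Sum>m<N. iterate m (x i) (x j) * ?s) + ?H (x i) (x j)"
          using separation_bounds[of n i j x] by (intro add_left_mono mult_left_le) auto
        finally show "1 * ?s \<le> (real N + 1) * (\<Sum>m<N. iterate m (x i) (x j) * ?s) + ?H (x i) (x j)" .
      qed (use sepint in simp)
      also have "\<dots> = (real N + 1) * (\<integral>x. (\<Sum>m<N. iterate m (x i) (x j) * separation n i j x) \<partial>points n)
          + measure (M \<Otimes>\<^sub>M M) (H N)"
        using Bochner_Integration.integral_add[OF Wint Hxint] integral_points_pair[OF H ij False] Hint by simp
      also have "(\<integral>x. (\<Sum>m<N. iterate m (x i) (x j) * separation n i j x) \<partial>points n) = (\<Sum>m<N. ?S (iterate m) i j)"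
        by (intro Bochner_Integration.integral_sum separated_integrable[OF unit_kernel_iterate] ij)
      finally show ?thesis .
    qed
    have "(\<Sum>i\<in>{1..n}. \<Sum>j\<in>{1..n}. ?S (\<lambda>_ _. 1) i j) \<le>
        (\<Sum>i\<in>{1..n}. \<Sum>j\<in>{1..n}. (real N + 1) * (\<Sum>m<N. ?S (iterate m) i j) + measure (M \<Otimes>\<^sub>M M) (H N))"
      by (intro sum_mono le)
    also have "\<dots> = (real N + 1) * (\<Sum>i\<in>{1..n}. \<Sum>j\<in>{1..n}. \<Sum>m<N. ?S (iterate m) i j) + (real n)\<^sup>2 * measure (M \<Otimes>\<^sub>M M) (H N)"
      by (simp add: sum.distrib sum_distrib_left power2_eq_square)
    also have "(\<Sum>i\<in>{1..n}. \<Sum>j\<in>{1..n}. \<Sum>m<N. ?S (iterate m) i j) = (\<Sum>m<N. \<Sum>i\<in>{1..n}. \<Sum>j\<in>{1..n}. ?S (iterate m) i j)"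
      by (subst sum.swap[of _ "{..<N}"], subst (2) sum.swap) simp
    finally have "separated_mass (\<lambda>_ _. 1) n \<le> ((real N + 1) * (\<Sum>m<N. \<Sum>i\<in>{1..n}. \<Sum>j\<in>{1..n}. ?S (iterate m) i j)
        + (real n)\<^sup>2 * measure (M \<Otimes>\<^sub>M M) (H N)) / (real n)\<^sup>2"
      unfolding separated_mass_def by (intro divide_right_mono) auto
    also have "\<dots> = (real N + 1) * (\<Sum>m<N. separated_mass (iterate m) n) + measure (M \<Otimes>\<^sub>M M) (H N)"
      using False unfolding separated_mass_def by (simp add: add_divide_distrib flip: sum_divide_distrib)
    finally show ?thesis .
  qed (auto simp: separated_mass_def sum_nonneg)
  have one: "unit_kernel (\<lambda>_ _. 1)" by (simp add: unit_kernel_def)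
  show ?thesis
  proof (rule LIMSEQ_I)
    fix r :: real assume r: "0 < r"
    \<comment> \<open>\<open>N\<close> is fixed first, so that only finitely many iterates remain
      when \<open>n\<close> tends to infinity.\<close>
    obtain N where N: "measure (M \<Otimes>\<^sub>M M) (H N) < r / 2"
      using LIMSEQ_D[OF H_lim, of "r / 2"] r by auto
    have "(\<lambda>n. (real N + 1) * (\<Sum>m<N. separated_mass (iterate m) n)) \<longlonglongrightarrow> (real N + 1) * (\<Sum>m<N. 0)"
      by (intro tendsto_mult tendsto_const tendsto_sum tendsto_separated_mass_iterate)
    then have "\<exists>n0. \<forall>n\<ge>n0. norm ((real N + 1) * (\<Sum>m<N. separated_mass (iterate m) n) - 0) < r / 2"
      using r by (intro LIMSEQ_D) auto
    then obtain n0 where n0: "\<And>n. n \<ge> n0 \<Longrightarrow> norm ((real N + 1) * (\<Sum>m<N. separated_mass (iterate m) n)) < r / 2"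
      by auto
    have "norm (separated_mass (\<lambda>_ _. 1) n - 0) < r" if "n \<ge> n0" for n
      using bound[of n N] n0[OF that] N separated_mass_nonneg[OF one, of n] by auto
    then show "\<exists>n0. \<forall>n\<ge>n0. norm (separated_mass (\<lambda>_ _. 1) n - 0) < r" by blast
  qed
qed

end

section \<open>The subcritical case\<close>

text \<open>Chebyshev's inequality for the number \<open>N\<close> of events that occur, with mean
  \<open>?m\<close>: if none occurs, then \<open>(N - ?m)^2 = ?m^2\<close>.\<close>

lemma (in prob_space) second_moment_bound:
  fixes A :: "'i \<Rightarrow> 'a set" and c d :: real
  assumes I: "finite I" "I \<noteq> {}" and A: "\<And>i. i \<in> I \<Longrightarrow> A i \<in> events"
    and c: "\<And>i. i \<in> I \<Longrightarrow> prob (A i) = c" "0 < c"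
    and d: "\<And>i j. i \<in> I \<Longrightarrow> j \<in> I \<Longrightarrow> i \<noteq> j \<Longrightarrow> prob (A i \<inter> A j) \<le> d" "0 \<le> d"
  shows "prob (space M - (\<Union>i\<in>I. A i)) \<le> 1 / (card I * c) + d / c\<^sup>2 - 1"
proof -
  define N where "N \<omega> = (\<Sum>i\<in>I. indicator (A i) \<omega> :: real)" for \<omega>
  let ?m = "card I * c"
  have card: "0 < card I" using I by (simp add: card_gt_0_iff)
  have m: "0 < ?m" using card c by simp
  have int1: "integrable M N"
    unfolding N_def using A by (intro Bochner_Integration.integrable_sum integrable_real_indicator) (auto simp: emeasure_eq_measure)
  have N2: "(N \<omega>)\<^sup>2 = (\<Sum>i\<in>I. \<Sum>j\<in>I. indicator (A i \<inter> A j) \<omega>)" for \<omega>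
    by (simp add: N_def power2_eq_square sum_product indicator_inter_arith)
  have int2: "integrable M (\<lambda>\<omega>. (N \<omega>)\<^sup>2)"
    unfolding N2 using A by (intro Bochner_Integration.integrable_sum integrable_real_indicator) (auto simp: emeasure_eq_measure)
  have EN: "expectation N = ?m"
    unfolding N_def using A c by (subst Bochner_Integration.integral_sum) (auto simp: emeasure_eq_measure)
  have "expectation (\<lambda>\<omega>. (N \<omega>)\<^sup>2) = (\<Sum>i\<in>I. \<Sum>j\<in>I. prob (A i \<inter> A j))"
    unfolding N2 using A by (simp add: Bochner_Integration.integral_sum emeasure_eq_measure)
  \<comment> \<open>Charging \<open>d \<ge> 0\<close> on the diagonal as well completes the sum to a
    full square.\<close>
  also have "\<dots> \<le> (\<Sum>i\<in>I. \<Sum>j\<in>I. (if i = j then c else 0) + d)"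
    using c d by (intro sum_mono) auto
  also have "\<dots> = ?m + (card I)\<^sup>2 * d"
    using I by (simp add: sum.distrib power2_eq_square algebra_simps)
  finally have EN2: "expectation (\<lambda>\<omega>. (N \<omega>)\<^sup>2) \<le> ?m + (card I)\<^sup>2 * d" .
  let ?Z = "space M - (\<Union>i\<in>I. A i)"
  have Z: "?Z \<in> events" using A I by (intro sets.Diff sets.finite_UN) auto
  have "prob ?Z * ?m\<^sup>2 = expectation (\<lambda>\<omega>. indicator ?Z \<omega> * ?m\<^sup>2)"
    using Z by simp
  also have "\<dots> \<le> expectation (\<lambda>\<omega>. (N \<omega>)\<^sup>2 - 2 * ?m * N \<omega> + ?m\<^sup>2)"
  proof (rule integral_mono)
    show "integrable M (\<lambda>\<omega>. indicator ?Z \<omega> * ?m\<^sup>2)"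
      using Z by (intro integrable_mult_left integrable_real_indicator) (auto simp: emeasure_eq_measure)
    show "integrable M (\<lambda>\<omega>. (N \<omega>)\<^sup>2 - 2 * ?m * N \<omega> + ?m\<^sup>2)"
      using int1 int2 by simp
    fix \<omega>
    have "N \<omega> = 0" if "\<omega> \<in> ?Z"
      using that by (auto simp: N_def indicator_def)
    then show "indicator ?Z \<omega> * ?m\<^sup>2 \<le> (N \<omega>)\<^sup>2 - 2 * ?m * N \<omega> + ?m\<^sup>2"
      using sum_squares_bound[of ?m "N \<omega>"] by (cases "\<omega> \<in> ?Z") (auto simp: algebra_simps)
  qed
  also have "\<dots> = expectation (\<lambda>\<omega>. (N \<omega>)\<^sup>2) - ?m\<^sup>2"
    using int1 int2 EN by (simp add: prob_space power2_eq_square)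
  also have "\<dots> \<le> ?m + (card I)\<^sup>2 * d - ?m\<^sup>2"
    using EN2 by simp
  finally have "prob ?Z \<le> (?m + (card I)\<^sup>2 * d - ?m\<^sup>2) / ?m\<^sup>2"
    by (simp only: pos_le_divide_eq[OF zero_less_power[OF m]])
  also have "\<dots> = 1 / ?m + d / c\<^sup>2 - 1"
    using card c by (simp add: field_simps power2_eq_square)
  finally show ?thesis .
qed

lemma exp_le_one_minus:
  fixes t :: real
  assumes "0 \<le> t" "t \<le> 1 / 2"
  shows "exp (- t - 2 * t\<^sup>2) \<le> 1 - t"
  using ln_one_minus_pos_lower_bound[OF assms] assms exp_le_cancel_iff[of "- t - 2 * t\<^sup>2" "ln (1 - t)"] by simp

context regular_kernel
begin

abbreviation conn :: "nat pair_pre_digraph \<Rightarrow> bool" where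
  "conn G \<equiv> Digraph_Component.connected (with_proj G)"

text \<open>A connected graph has no isolated vertex, so the second moment bound is applied to the
  isolation events, with \<open>?c\<close> their probability and \<open>?d\<close> a bound for two
  at once.\<close>

lemma connected_prob_le:
  assumes n: "2 \<le> n" and small: "ln n / n * deg \<le> 1 / 2"
  defines "p \<equiv> ln n / n"
  shows "measure (\<G> n) {G. conn G} \<le>
    1 / (n * exp (- (real n - 1) * (p * deg + 2 * (p * deg)\<^sup>2)))
    + exp (- (real n - 2) * (2 * p * deg - 2 * p\<^sup>2 * sq) + 2 * (real n - 1) * (p * deg + 2 * (p * deg)\<^sup>2)) - 1"
proof -
  interpret R: prob_space "\<G> n" by (rule prob_space_kernel_graph)
  let ?a = "\<integral>z. min 1 (\<kappa> undefined z * p) \<partial>M"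
  let ?c = "(1 - ?a) ^ (n - 1)" and ?d = "exp (- (2 * p * deg - 2 * p\<^sup>2 * sq)) ^ (n - 2)"
  let ?b = "exp (- (real n - 1) * (p * deg + 2 * (p * deg)\<^sup>2))"
  have p: "0 \<le> p" using n by (simp add: p_def)
  have int: "integrable M (\<lambda>z. min 1 (\<kappa> undefined z * p))"
    using p kernel_nonneg by (intro integrable_const_bound[where B=1]) auto
  have "?a \<le> (\<integral>z. \<kappa> undefined z * p \<partial>M)"
    by (intro integral_mono int integrable_mult_left kernel_integrable) auto
  also have "\<dots> = p * deg"
    by (simp add: integral_kernel)
  finally have a: "?a \<le> p * deg" .
  have pd: "0 \<le> p * deg" "p * deg \<le> 1 / 2"
    using mult_nonneg_nonneg[OF p deg_nonneg] small by (simp_all add: p_def)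
  have "?b = exp (- (p * deg) - 2 * (p * deg)\<^sup>2) ^ (n - 1)"
    using n by (subst exp_of_nat_mult[symmetric]) (simp add: of_nat_diff algebra_simps)
  also have "\<dots> \<le> (1 - p * deg) ^ (n - 1)"
    by (intro power_mono exp_le_one_minus pd) simp
  also have "\<dots> \<le> ?c"
    using a pd by (intro power_mono) auto
  finally have c: "?b \<le> ?c" .
  \<comment> \<open>If two vertices are isolated, no edge leaves the pair; the possible edge between
    them is ignored, which suffices for an upper bound.\<close>
  have cross: "no_cross n {i, j} G" if "no_cross n {i} G" "no_cross n {j} G" for i j G
    using that by (auto simp: no_cross_def)
  let ?A = "\<lambda>i. {G. no_cross n {i} G}"
  have "measure (\<G> n) {G. conn G} \<le> measure (\<G> n) (space (\<G> n) - (\<Union>i\<in>{1..n}. ?A i))"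
  proof (rule R.finite_measure_mono_AE)
    show "AE G in \<G> n. G \<in> {G. conn G} \<longrightarrow> G \<in> space (\<G> n) - (\<Union>i\<in>{1..n}. ?A i)"
      using AE_random_graph[of n]
    proof eventually_elim
      case (elim G)
      then obtain e where G: "G = graph_of n e" by auto
      have "\<not> no_cross n {i} G" if "conn G" "i \<in> {1..n}" for i
      proof -
        have "card {i} \<noteq> card {1..n}" using n by simp
        then have "{i} \<noteq> {1..n}" by metis
        then have "{i} \<subset> {1..n}" using that by (intro psubsetI) simp_all
        then show ?thesis
          using connected_imp_not_no_cross[of n e i "{i}"] that G by simp
      qed
      then show ?case by auto
    qed
  qed auto
  also have "\<dots> \<le> 1 / (card {1..n} * ?c) + ?d / ?c\<^sup>2 - 1"
  proof (rule R.second_moment_bound)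
    show "0 < ?c" using c by (rule less_le_trans[rotated]) simp
    show "measure (\<G> n) (?A i) = ?c" if "i \<in> {1..n}" for i
      using prob_no_cross_singleton[OF that] by (simp add: p_def)
    fix i j assume ij: "i \<in> {1..n}" "j \<in> {1..n}" "i \<noteq> j"
    have "measure (\<G> n) (?A i \<inter> ?A j) \<le> measure (\<G> n) {G. no_cross n {i, j} G}"
      using cross by (intro R.finite_measure_mono) auto
    also have "\<dots> \<le> exp (- (2 * p * deg - 2 * p\<^sup>2 * sq)) ^ (n - card {i, j})"
    proof (rule prob_no_cross_le)
      show "1 - 2 * p * deg + (2 * p)\<^sup>2 * sq / 2 \<le> exp (- (2 * p * deg - 2 * p\<^sup>2 * sq))"
        using exp_ge_add_one_self[of "- (2 * p * deg - 2 * p\<^sup>2 * sq)"] by (simp add: power_mult_distrib algebra_simps)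
      show "2 \<le> card {i, j}" using ij by simp
      show "2 * p = real 2 * (ln (real n) / real n)" by (simp add: p_def)
    qed (use ij n in auto)
    also have "n - card {i, j} = n - 2" using ij by simp
    finally show "measure (\<G> n) (?A i \<inter> ?A j) \<le> ?d" .
  qed (use n in auto)
  \<comment> \<open>The bound decreases in \<open>?c\<close>, so the lower bound \<open>?b\<close>
    may replace it.\<close>
  also have "\<dots> \<le> 1 / (n * ?b) + ?d / ?b\<^sup>2 - 1"
    using c n by (intro diff_right_mono add_mono divide_left_mono mult_left_mono power_mono mult_pos_pos zero_less_power
        less_le_trans[OF _ c]) auto
  also have "?d / ?b\<^sup>2 = exp (- (real n - 2) * (2 * p * deg - 2 * p\<^sup>2 * sq) + 2 * (real n - 1) * (p * deg + 2 * (p * deg)\<^sup>2))"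
  proof -
    have "?d = exp (- (real n - 2) * (2 * p * deg - 2 * p\<^sup>2 * sq))"
      using n by (subst exp_of_nat_mult[symmetric]) (simp add: of_nat_diff algebra_simps)
    moreover have "?b\<^sup>2 = exp (- (2 * (real n - 1) * (p * deg + 2 * (p * deg)\<^sup>2)))"
      by (subst exp_double[symmetric]) (simp add: algebra_simps)
    ultimately show ?thesis
      by (simp add: exp_add exp_minus divide_inverse)
  qed
  finally show ?thesis .
qed

text \<open>In the bound of \<open>connected_prob_le\<close> the first denominator has order
  \<open>n powr (1 - deg)\<close>. In the second exponent the terms of order \<open>ln n\<close>
  cancel, leaving terms of order at most \<open>(ln n)^2 / n\<close>.\<close>

lemma tendsto_prob_connected_0:
  assumes deg: "deg < 1"
  shows "(\<lambda>n. measure (\<G> n) {G. conn G}) \<longlonglongrightarrow> 0"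
proof (rule tendsto_sandwich)
  define L K where "L = deg" and "K = sq"
  have L: "L < 1" using deg by (simp add: L_def)
  have "(\<lambda>n. ln (real n) / n * L) \<longlonglongrightarrow> 0" by real_asymp
  then have small: "\<forall>\<^sub>F n in sequentially. ln (real n) / n * L < 1 / 2"
    by (rule order_tendstoD) simp
  let ?B = "\<lambda>n. 1 / (n * exp (- (real n - 1) * (ln (real n) / n * L + 2 * (ln (real n) / n * L)\<^sup>2)))
    + exp (- (real n - 2) * (2 * (ln (real n) / n) * L - 2 * (ln (real n) / n)\<^sup>2 * K)
       + 2 * (real n - 1) * (ln (real n) / n * L + 2 * (ln (real n) / n * L)\<^sup>2)) - 1"
  show "\<forall>\<^sub>F n in sequentially. 0 \<le> measure (\<G> n) {G. conn G}"
    by simp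
  show "\<forall>\<^sub>F n in sequentially. measure (\<G> n) {G. conn G} \<le> ?B n"
    using small eventually_ge_at_top[of 2]
  proof eventually_elim
    case (elim n)
    then show ?case unfolding L_def K_def by (intro connected_prob_le) simp_all
  qed
  have 1: "(\<lambda>n. 1 / (n * exp (- (real n - 1) * (ln (real n) / n * L + 2 * (ln (real n) / n * L)\<^sup>2)))) \<longlonglongrightarrow> 0"
  proof -
    have "(\<lambda>n. exp (- ((1 - L) * ln (real n))) * exp (- (ln (real n) / n * L) + 2 * (real n - 1) * (ln (real n) / n)\<^sup>2 * L\<^sup>2)) 
        \<longlonglongrightarrow> 0 * exp (- (0 * L) + 0 * L\<^sup>2)"
    proof (intro tendsto_mult tendsto_exp tendsto_add tendsto_minus tendsto_const)
      have "(\<lambda>n. exp (- (q * ln (real n)))) \<longlonglongrightarrow> 0" if "0 < q" for q :: real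
        using that by real_asymp
      then show "(\<lambda>n. exp (- ((1 - L) * ln (real n)))) \<longlonglongrightarrow> 0"
        using L by simp
      show "(\<lambda>n. ln (real n) / n) \<longlonglongrightarrow> 0" "(\<lambda>n. 2 * (real n - 1) * (ln (real n) / n)\<^sup>2) \<longlonglongrightarrow> 0"
        by real_asymp+
    qed
    then have "(\<lambda>n. exp ((real n - 1) * (ln (real n) / n * L + 2 * (ln (real n) / n * L)\<^sup>2) - ln n))
        \<longlonglongrightarrow> 0 * exp (- (0 * L) + 0 * L\<^sup>2)"
    proof (rule Lim_transform_eventually)
      show "\<forall>\<^sub>F n in sequentially. exp (- ((1 - L) * ln (real n))) * exp (- (ln (real n) / n * L) + 2 * (real n - 1) * (ln (real n) / n)\<^sup>2 * L\<^sup>2)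
         = exp ((real n - 1) * (ln (real n) / n * L + 2 * (ln (real n) / n * L)\<^sup>2) - ln n)"
        using eventually_gt_at_top[of 0]
      proof eventually_elim
        case (elim n)
        have "- ((1 - L) * l) + (- (l / m * L) + 2 * (m - 1) * (l / m)\<^sup>2 * L\<^sup>2) =
            (m - 1) * (l / m * L + 2 * (l / m * L)\<^sup>2) - l" if "m \<noteq> 0" for l m :: real
          using that by (simp add: field_simps power2_eq_square)
        with elim show ?case
          by (simp only: exp_add[symmetric])
      qed
    qed
    moreover have "\<forall>\<^sub>F n in sequentially. exp ((real n - 1) * (ln (real n) / n * L + 2 * (ln (real n) / n * L)\<^sup>2) - ln n)
       = 1 / (n * exp (- (real n - 1) * (ln (real n) / n * L + 2 * (ln (real n) / n * L)\<^sup>2)))"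
      using eventually_gt_at_top[of 0]
    proof eventually_elim
      case (elim n)
      let ?t = "(real n - 1) * (ln (real n) / n * L + 2 * (ln (real n) / n * L)\<^sup>2)"
      have "exp (t - ln m) = 1 / (m * exp (- t))" if "0 < m" for t m :: real
        using that by (simp add: exp_diff exp_minus field_simps)
      from this[of n ?t] show ?case
        using elim by (simp only: mult_minus_left of_nat_0_less_iff)
    qed
    ultimately show ?thesis
      using Lim_transform_eventually by fastforce
  qed
  have "(\<lambda>n. - (real n - 2) * (2 * (ln (real n) / n) * L - 2 * (ln (real n) / n)\<^sup>2 * K)
       + 2 * (real n - 1) * (ln (real n) / n * L + 2 * (ln (real n) / n * L)\<^sup>2)) \<longlonglongrightarrow> 0"
  proof -
    have "(\<lambda>n. 2 * (ln (real n) / n) * L + 2 * (real n - 2) * (ln (real n) / n)\<^sup>2 * K + 4 * (real n - 1) * (ln (real n) / n)\<^sup>2 * L\<^sup>2) \<longlonglongrightarrow> 0 + 0 * K + 0 * L\<^sup>2"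
      by (intro tendsto_add tendsto_mult tendsto_const; real_asymp)
    moreover have "2 * u * L + 2 * (m - 2) * u\<^sup>2 * K + 4 * (m - 1) * u\<^sup>2 * L\<^sup>2 =
        - (m - 2) * (2 * u * L - 2 * u\<^sup>2 * K) + 2 * (m - 1) * (u * L + 2 * (u * L)\<^sup>2)" for u m :: real
      by (simp add: algebra_simps power2_eq_square)
    ultimately show ?thesis by (simp only: mult_zero_left add_0_left)
  qed
  from tendsto_diff[OF tendsto_add[OF 1 tendsto_exp[OF this]] tendsto_const[of 1]]
  show "?B \<longlonglongrightarrow> 0" by simp
qed simp

end

section \<open>The supercritical case\<close>

lemma sum_power_card_Pow:
  fixes x :: real
  assumes "finite V"
  shows "(\<Sum>S\<in>Pow V. x ^ card S) = (1 + x) ^ card V"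
  using prod_add[OF assms, of "\<lambda>_. x" "\<lambda>_. 1"] by (simp add: add.commute)

context regular_kernel
begin

text \<open>Markov's inequality for the number of separated ordered pairs, whose mean is
  \<open>n^2\<close> times the separated mass of the constant 1.\<close>

lemma prob_many_separated_pairs:
  fixes \<epsilon> :: real
  assumes \<epsilon>: "0 < \<epsilon>" and n: "n \<noteq> 0"
  shows "measure (\<G> n) {G. \<epsilon> * n * n \<le> card {a \<in> {1..n} \<times> {1..n}. a \<notin> (parcs G)\<^sup>*}}
    \<le> separated_mass (\<lambda>_ _. 1) n / \<epsilon>"
proof -
  interpret R: prob_space "\<G> n" by (rule prob_space_kernel_graph)
  let ?D = "{G. \<epsilon> * n * n \<le> card {a \<in> {1..n} \<times> {1..n}. a \<notin> (parcs G)\<^sup>*}}"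
  let ?N = "\<lambda>a. {G. a \<notin> (parcs G)\<^sup>*} :: nat pair_pre_digraph set"
  have int: "integrable (\<G> n) (indicator A :: _ \<Rightarrow> real)" for A
    by (intro integrable_real_indicator) (auto simp: R.emeasure_eq_measure)
  have "measure (\<G> n) ?D * (\<epsilon> * n * n) = (\<integral>G. indicator ?D G * (\<epsilon> * n * n) \<partial>\<G> n)"
    by simp
  also have "\<dots> \<le> (\<integral>G. (\<Sum>a\<in>{1..n} \<times> {1..n}. indicator (?N a) G) \<partial>\<G> n)"
  proof (intro integral_mono integrable_mult_left Bochner_Integration.integrable_sum int)
    fix G
    have "(\<Sum>a\<in>{1..n} \<times> {1..n}. indicator (?N a) G :: real) = card {a \<in> {1..n} \<times> {1..n}. a \<notin> (parcs G)\<^sup>*}"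
      by (simp add: indicator_def sum.If_cases Int_def del: mem_Sigma_iff)
    then show "indicator ?D G * (\<epsilon> * n * n) \<le> (\<Sum>a\<in>{1..n} \<times> {1..n}. indicator (?N a) G)"
      by (auto simp: indicator_def)
  qed
  also have "\<dots> = (\<Sum>a\<in>{1..n} \<times> {1..n}. measure (\<G> n) (?N a))"
    by (simp add: Bochner_Integration.integral_sum int)
  also have "\<dots> = (\<Sum>i\<in>{1..n}. \<Sum>j\<in>{1..n}. \<integral>x. 1 * separation n i j x \<partial>points n)"
    by (simp add: sum.cartesian_product measure_random_graph separation_def case_prod_beta')
  also have "\<dots> = separated_mass (\<lambda>_ _. 1) n * (real n * real n)"
    using n by (simp add: separated_mass_def power2_eq_square)
  finally show ?thesis
    using \<epsilon> n by (simp add: field_simps)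
qed

text \<open>Either some nonempty set of at most \<open>\<epsilon> * n\<close> vertices has no
  crossing edge, or every component is larger and \<open>many_separated_pairs\<close>
  applies.\<close>

lemma disconnected_prob_le:
  fixes \<epsilon> :: real
  assumes \<epsilon>: "0 < \<epsilon>" and n: "n \<noteq> 0"
  shows "measure (\<G> n) {G. \<not> conn G} \<le>
    (\<Sum>S | S \<subseteq> {1..n} \<and> S \<noteq> {} \<and> card S \<le> \<epsilon> * n. measure (\<G> n) {G. no_cross n S G})
    + separated_mass (\<lambda>_ _. 1) n / \<epsilon>"
proof -
  interpret R: prob_space "\<G> n" by (rule prob_space_kernel_graph)
  let ?D = "{G. \<epsilon> * n * n \<le> card {a \<in> {1..n} \<times> {1..n}. a \<notin> (parcs G)\<^sup>*}}"
  let ?F = "{S. S \<subseteq> {1..n} \<and> S \<noteq> {} \<and> card S \<le> \<epsilon> * n}"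
  let ?U = "\<Union>S\<in>?F. {G. no_cross n S G}"
  have fin: "finite ?F" by simp
  have "measure (\<G> n) {G. \<not> conn G} \<le> measure (\<G> n) (?U \<union> ?D)"
  proof (rule R.finite_measure_mono_AE)
    show "AE G in \<G> n. G \<in> {G. \<not> conn G} \<longrightarrow> G \<in> ?U \<union> ?D"
      using AE_random_graph[of n]
    proof eventually_elim
      case (elim G)
      then obtain e where G: "G = graph_of n e" by auto
      show ?case
      proof (cases "\<exists>S\<in>?F. no_cross n S G")
        case False
        have "G \<in> ?D" if "\<not> conn G"
          using False that n unfolding G mem_Collect_eq by (intro many_separated_pairs) (auto simp: not_le)
        then show ?thesis by simp
      qed auto
    qed
  qed simp
  moreover have "measure (\<G> n) (?U \<union> ?D) \<le> measure (\<G> n) ?U + measure (\<G> n) ?D"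
    by (intro measure_Un_le) simp_all
  moreover have "measure (\<G> n) ?U \<le> (\<Sum>S\<in>?F. measure (\<G> n) {G. no_cross n S G})"
    by (rule R.finite_measure_subadditive_finite[OF fin, of "\<lambda>S. {G. no_cross n S G}"]) simp
  ultimately show ?thesis
    using prob_many_separated_pairs[OF \<epsilon> n] by linarith
qed

text \<open>The whole of \<open>S\<close> serves in the avoidance bound. As
  \<open>t \<le> \<delta>\<close>, the quadratic term costs at most half of the surplus
  \<open>deg - 1\<close>, and the rate \<open>(1 + deg) / 2\<close> still exceeds 1.\<close>

lemma prob_no_cross_small:
  assumes S: "S \<subseteq> {1..n}" and n: "n \<noteq> 0" and deg: "1 < deg"
    and \<delta>: "0 < \<delta>" "\<delta> * sq \<le> deg - 1" and small: "card S * (ln n / n) \<le> \<delta>"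
  shows "measure (\<G> n) {G. no_cross n S G} \<le> exp ((1 + deg) / 2 * (\<delta> - ln n)) ^ card S"
proof -
  let ?k = "card S" and ?l = "(1 + deg) / 2"
  define t where "t = ?k * (ln (real n) / n)"
  have k: "?k \<le> n" using S card_mono[of "{1..n}" S] by simp
  have t: "0 \<le> t" "t \<le> \<delta>" using n small by (simp_all add: t_def)
  have "t * sq \<le> deg - 1"
    using mult_right_mono[OF t(2) sq_nonneg] \<delta> by simp
  then have "t\<^sup>2 * sq / 2 \<le> t * (deg - 1) / 2"
    using mult_left_mono[OF _ t(1), of "t * sq" "deg - 1"] by (simp add: power2_eq_square mult_ac)
  then have "1 - t * deg + t\<^sup>2 * sq / 2 \<le> 1 + (- (t * ?l))"
    by (simp add: field_simps)
  also have "\<dots> \<le> exp (- (t * ?l))"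
    by (rule exp_ge_add_one_self)
  finally have "measure (\<G> n) {G. no_cross n S G} \<le> exp (- (t * ?l)) ^ (n - ?k)"
    by (rule prob_no_cross_le[OF S order_refl n t_def])
  \<comment> \<open>Having \<open>n - ?k\<close> rather than \<open>n\<close> outside vertices turns
    \<open>ln n\<close> into \<open>ln n - t\<close>, and \<open>t \<le> \<delta>\<close>.\<close>
  also have "\<dots> = exp (- (?l * ?k * (ln n - t)))"
    using n k by (subst exp_of_nat_mult[symmetric]) (simp add: of_nat_diff t_def field_simps)
  also have "\<dots> \<le> exp (?l * ?k * (\<delta> - ln n))"
  proof -
    have "?l * ?k * (ln n - \<delta>) \<le> ?l * ?k * (ln n - t)"
      using t deg by (intro mult_left_mono) auto
    then have "- (?l * ?k * (ln n - t)) \<le> - (?l * ?k * (ln n - \<delta>))"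
      by (simp only: neg_le_iff_le)
    also have "\<dots> = ?l * ?k * (\<delta> - ln n)"
      by (simp only: mult_minus_right[symmetric] minus_diff_eq)
    finally show ?thesis by (simp only: exp_le_cancel_iff)
  qed
  also have "\<dots> = exp (?l * (\<delta> - ln n)) ^ ?k"
    by (subst exp_of_nat_mult[symmetric]) (simp add: mult_ac)
  finally show ?thesis .
qed

text \<open>For the full set the quadratic term could dominate, so only \<open>k\<close> of its
  vertices are used. Each of the at least \<open>n / 2\<close> outside vertices then contributes a
  constant factor below 1.\<close>

lemma prob_no_cross_medium:
  assumes S: "S \<subseteq> {1..n}" and n: "n \<noteq> 0" and deg: "1 < deg"
    and \<delta>: "0 < \<delta>" "\<delta> * sq \<le> deg - 1" and large: "\<delta> < card S * (ln n / n)"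
    and p: "ln n / n \<le> \<delta> / 2" and half: "card S \<le> n / 2"
  shows "measure (\<G> n) {G. no_cross n S G} \<le> exp (- (\<delta> * n / 4))"
proof -
  let ?p = "ln (real n) / n"
  have p0: "0 < ?p"
    using n \<delta>(1) large by (smt (verit, best) mult_nonneg_nonpos of_nat_0_le_iff)
  \<comment> \<open>The largest \<open>k\<close> with \<open>k * ?p \<le> \<delta>\<close>: rounding
    down loses less than \<open>?p \<le> \<delta> / 2\<close>, so \<open>t\<close> is at least
    \<open>\<delta> / 2\<close>.\<close>
  define k where "k = nat \<lfloor>\<delta> / ?p\<rfloor>"
  define t where "t = k * ?p"
  have kreal: "real k = of_int \<lfloor>\<delta> / ?p\<rfloor>"
    unfolding k_def using \<delta>(1) p0 by (intro of_nat_nat) (simp only: zero_le_floor divide_nonneg_pos less_imp_le)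
  have "real k \<le> \<delta> / ?p" "\<delta> / ?p < real k + 1"
    unfolding kreal by linarith+
  then have t: "t \<le> \<delta>" "\<delta> < t + ?p"
    using p0 by (simp_all only: t_def pos_le_divide_eq pos_divide_less_eq distrib_right mult_1)
  then have t2: "\<delta> / 2 \<le> t" using p by linarith
  have t0: "0 \<le> t" using t2 \<delta> by linarith
  have "real k * ?p < card S * ?p"
    using t large by (simp only: t_def)
  then have k: "k \<le> card S"
    using p0 by (simp only: mult_less_cancel_right_pos of_nat_less_iff less_imp_le)
  have "t * sq \<le> deg - 1"
    using mult_right_mono[OF t(1) sq_nonneg] \<delta> by simp
  then have "t\<^sup>2 * sq / 2 \<le> t * (deg - 1) / 2"
    using mult_left_mono[OF _ t0, of "t * sq" "deg - 1"] by (simp add: power2_eq_square mult_ac)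
  then have "1 - t * deg + t\<^sup>2 * sq / 2 \<le> 1 + (- (t * ((1 + deg) / 2)))"
    by (simp add: field_simps)
  also have "\<dots> \<le> 1 + (- (\<delta> / 2))"
    using mult_mono[of "\<delta> / 2" t 1 "(1 + deg) / 2"] t2 deg t0 by simp
  also have "\<dots> \<le> exp (- (\<delta> / 2))"
    by (rule exp_ge_add_one_self)
  finally have "measure (\<G> n) {G. no_cross n S G} \<le> exp (- (\<delta> / 2)) ^ (n - card S)"
    by (rule prob_no_cross_le[OF S k n t_def])
  also have "\<dots> = exp (- (real (n - card S) * (\<delta> / 2)))"
    by (subst exp_of_nat_mult[symmetric]) simp
  also have "\<dots> \<le> exp (- (n / 2 * (\<delta> / 2)))"
  proof -
    have "n / 2 \<le> real (n - card S)"
      using half by (simp add: of_nat_diff)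
    then show ?thesis using \<delta> by (simp add: mult_right_mono)
  qed
  finally show ?thesis by (simp add: mult.commute)
qed

text \<open>Both bounds are brought into the form of a constant times a power with exponent
  \<open>card S\<close>, so that the sum over all subsets is binomial. Of the rate
  \<open>\<delta> / 4\<close>, two losses of \<open>\<delta> / 16\<close> leave
  \<open>\<delta> / 8\<close>.\<close>

lemma sum_no_cross_le:
  fixes \<delta> \<epsilon> s :: real
  assumes n: "n \<noteq> 0" and deg: "1 < deg"
    and \<delta>: "0 < \<delta>" "\<delta> * sq \<le> deg - 1" and p: "ln n / n \<le> \<delta> / 2"
    and s: "exp (- s) \<le> \<delta> / 16" "\<epsilon> * s \<le> \<delta> / 16" "0 < s" and \<epsilon>: "\<epsilon> \<le> 1 / 2"
  shows "(\<Sum>S | S \<subseteq> {1..n} \<and> S \<noteq> {} \<and> card S \<le> \<epsilon> * n. measure (\<G> n) {G. no_cross n S G})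
    \<le> exp (n * exp ((1 + deg) / 2 * (\<delta> - ln n))) - 1 + exp (- (\<delta> * n / 8))"
proof -
  let ?F = "{S. S \<subseteq> {1..n} \<and> S \<noteq> {} \<and> card S \<le> \<epsilon> * n}"
  let ?r = "exp ((1 + deg) / 2 * (\<delta> - ln n))"
  let ?A = "exp (\<epsilon> * s * n - \<delta> * n / 4)"
  have "measure (\<G> n) {G. no_cross n S G} \<le> ?r ^ card S + ?A * exp (- s) ^ card S" if "S \<in> ?F" for S
  proof (cases "card S * (ln n / n) \<le> \<delta>")
    case True
    then have "measure (\<G> n) {G. no_cross n S G} \<le> ?r ^ card S"
      using that by (intro prob_no_cross_small n deg \<delta>) auto
    then show ?thesis by (rule order.trans) simp
  next
    case False
    have "measure (\<G> n) {G. no_cross n S G} \<le> exp (- (\<delta> * n / 4))"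
    proof (rule prob_no_cross_medium[OF _ n deg \<delta> _ p])
      have "card S \<le> \<epsilon> * n" using that by simp
      also have "\<dots> \<le> n / 2" using mult_right_mono[OF \<epsilon>, of n] by simp
      finally show "card S \<le> n / 2" .
    qed (use that False in auto)
    \<comment> \<open>The added exponent is nonnegative because
      \<open>card S \<le> \<epsilon> * n\<close>; it introduces the power of
      \<open>exp (- s)\<close> that makes the sum over sets manageable.\<close>
    also have "\<dots> \<le> exp (- (\<delta> * n / 4) + s * (\<epsilon> * n - card S))"
      using that s by simp
    also have "\<dots> = ?A * exp (- s) ^ card S"
      by (subst exp_of_nat_mult[symmetric]) (simp add: exp_add[symmetric] algebra_simps)
    finally show ?thesis by (rule order.trans) simp
  qed
  then have "(\<Sum>S\<in>?F. measure (\<G> n) {G. no_cross n S G}) \<le> (\<Sum>S\<in>?F. ?r ^ card S + ?A * exp (- s) ^ card S)"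
    by (rule sum_mono)
  also have "\<dots> \<le> (\<Sum>S\<in>Pow {1..n} - {{}}. ?r ^ card S + ?A * exp (- s) ^ card S)"
    by (intro sum_mono2) auto
  \<comment> \<open>Removing the empty set subtracts the 1 that \<open>exp (n * ?r)\<close> tends
    to.\<close>
  also have "\<dots> = (\<Sum>S\<in>Pow {1..n}. ?r ^ card S + ?A * exp (- s) ^ card S) - (1 + ?A)"
    by (subst sum_diff1) auto
  also have "\<dots> = (1 + ?r) ^ n + ?A * (1 + exp (- s)) ^ n - (1 + ?A)"
    using sum_power_card_Pow[of "{1..n}"] by (simp add: sum.distrib sum_distrib_left[symmetric])
  also have "\<dots> \<le> exp (n * ?r) + ?A * exp (n * (\<delta> / 16)) - 1"
  proof -
    have pw: "(1 + x) ^ n \<le> exp (n * y)" if "0 \<le> x" "x \<le> y" for x y :: real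
    proof -
      have "1 + x \<le> exp y" using exp_ge_add_one_self[of y] that by linarith
      then have "(1 + x) ^ n \<le> exp y ^ n" using that by (intro power_mono) auto
      then show ?thesis by (simp add: exp_of_nat_mult)
    qed
    have "?A * (1 + exp (- s)) ^ n \<le> ?A * exp (n * (\<delta> / 16))"
      by (intro mult_left_mono pw s) simp_all
    moreover have "(1 + ?r) ^ n \<le> exp (n * ?r)"
      by (rule pw) simp_all
    moreover have "0 \<le> ?A" by simp
    ultimately show ?thesis by linarith
  qed
  also have "?A * exp (n * (\<delta> / 16)) \<le> exp (- (\<delta> * n / 8))"
  proof -
    have "\<epsilon> * s * n \<le> \<delta> / 16 * n" using s(2) by (rule mult_right_mono) simp
    then show ?thesis by (simp add: exp_add[symmetric] field_simps)
  qed
  finally show ?thesis by simp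
qed

lemma tendsto_prob_disconnected_0:
  assumes deg: "1 < deg" and irr: "\<not> reducible_kernel M \<kappa>"
  shows "(\<lambda>n. measure (\<G> n) {G. \<not> conn G}) \<longlonglongrightarrow> 0"
proof -
  \<comment> \<open>The constants are chosen in this order: \<open>\<delta>\<close> from the surplus
    \<open>deg - 1\<close>, then \<open>s\<close>, then \<open>\<epsilon>\<close> small relative to
    both.\<close>
  obtain \<delta> :: real where \<delta>: "0 < \<delta>" "\<delta> * sq \<le> deg - 1"
  proof
    show "0 < (deg - 1) / (sq + 1)" using deg sq_nonneg by simp
    show "(deg - 1) / (sq + 1) * sq \<le> deg - 1"
      using deg sq_nonneg by (simp add: field_simps)
  qed
  obtain s :: real where s: "exp (- s) \<le> \<delta> / 16" "0 < s"
  proof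
    have "- max 1 (- ln (\<delta> / 16)) \<le> ln (\<delta> / 16)" by simp
    then show "exp (- max 1 (- ln (\<delta> / 16))) \<le> \<delta> / 16"
      using \<delta> by (metis exp_le_cancel_iff exp_ln divide_pos_pos zero_less_numeral)
  qed simp
  define \<epsilon> where "\<epsilon> = min (1 / 2) (\<delta> / 16 / s)"
  have \<epsilon>: "0 < \<epsilon>" "\<epsilon> \<le> 1 / 2" "\<epsilon> * s \<le> \<delta> / 16"
    using \<delta> s by (auto simp: \<epsilon>_def min_def field_simps)
  let ?B = "\<lambda>n. exp (n * exp ((1 + deg) / 2 * (\<delta> - ln n))) - 1 + exp (- (\<delta> * n / 8))
    + separated_mass (\<lambda>_ _. 1) n / \<epsilon>"
  show ?thesis
  proof (rule tendsto_sandwich)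
    show "\<forall>\<^sub>F n in sequentially. 0 \<le> measure (\<G> n) {G. \<not> conn G}"
      by simp
    have "(\<lambda>n. ln (real n) / n) \<longlonglongrightarrow> 0" by real_asymp
    then have "\<forall>\<^sub>F n in sequentially. ln (real n) / n < \<delta> / 2"
      by (rule order_tendstoD) (use \<delta> in simp)
    then show "\<forall>\<^sub>F n in sequentially. measure (\<G> n) {G. \<not> conn G} \<le> ?B n"
      using eventually_gt_at_top[of 0]
    proof eventually_elim
      case (elim n)
      then show ?case
        using disconnected_prob_le[OF \<epsilon>(1), of n] sum_no_cross_le[OF _ deg \<delta> _ s(1) \<epsilon>(3) s(2) \<epsilon>(2), of n]
        by linarith
    qed
    \<comment> \<open>Up to a constant factor this is
      \<open>n powr (- (deg - 1) / 2)\<close>.\<close>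
    have 1: "(\<lambda>n. n * exp ((1 + deg) / 2 * (\<delta> - ln n))) \<longlonglongrightarrow> 0"
    proof -
      have "(\<lambda>n. exp (- (q * ln (real n)))) \<longlonglongrightarrow> 0" if "0 < q" for q :: real
        using that by real_asymp
      from tendsto_mult[OF tendsto_const[of "exp ((1 + deg) / 2 * \<delta>)"] this[of "(deg - 1) / 2"]] deg
      have "(\<lambda>n. exp ((1 + deg) / 2 * \<delta>) * exp (- ((deg - 1) / 2 * ln (real n)))) \<longlonglongrightarrow> 0" by simp
      moreover have "\<forall>\<^sub>F n in sequentially. exp ((1 + deg) / 2 * \<delta>) * exp (- ((deg - 1) / 2 * ln (real n)))
          = n * exp ((1 + deg) / 2 * (\<delta> - ln n))"
        using eventually_gt_at_top[of 0]
      proof eventually_elim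
        case (elim n)
        have "n * exp ((1 + deg) / 2 * (\<delta> - ln n)) = exp (ln n + (1 + deg) / 2 * (\<delta> - ln n))"
          using elim by (simp add: exp_add)
        also have "ln n + (1 + deg) / 2 * (\<delta> - ln n) = (1 + deg) / 2 * \<delta> + - ((deg - 1) / 2 * ln n)"
          by (simp add: field_simps)
        finally show ?case by (simp only: exp_add)
      qed
      ultimately show ?thesis by (rule Lim_transform_eventually)
    qed
    have 2: "(\<lambda>n. exp (- (\<delta> * real n / 8))) \<longlonglongrightarrow> 0"
      using \<delta>(1) by real_asymp
    have 3: "(\<lambda>n. separated_mass (\<lambda>_ _. 1) n / \<epsilon>) \<longlonglongrightarrow> 0 / \<epsilon>"
      using deg \<epsilon> by (intro tendsto_divide tendsto_separated_mass_one irr tendsto_const) auto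
    show "?B \<longlonglongrightarrow> 0"
      using tendsto_add[OF tendsto_add[OF tendsto_diff[OF tendsto_exp[OF 1] tendsto_const[of 1]] 2] 3] by simp
  qed simp
qed

end

section \<open>From homogeneity to equal laws, and the theorem\<close>

lemma regular_kernel_homogeneous:
  fixes M :: "'a measure" and \<kappa> :: "'a \<Rightarrow> 'a \<Rightarrow> real" and \<Gamma> :: "('g, 'm) monoid_scheme"
  assumes M: "prob_space M" "space M = UNIV"
    and nonneg: "\<And>x y. 0 \<le> \<kappa> x y"
    and sym: "\<And>x y. \<kappa> x y = \<kappa> y x"
    and meas: "(\<lambda>(x, y). \<kappa> x y) \<in> borel_measurable (M \<Otimes>\<^sub>M M)"
    and sq: "integrable (M \<Otimes>\<^sub>M M) (\<lambda>(x, y). (\<kappa> x y)\<^sup>2)"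
    and trans: "transitive_action \<Gamma> UNIV \<phi>"
    and \<phi>: "\<And>g. g \<in> carrier \<Gamma> \<Longrightarrow> \<phi> g \<in> M \<rightarrow>\<^sub>M M" "\<And>g. g \<in> carrier \<Gamma> \<Longrightarrow> distr M M (\<phi> g) = M"
    and inv: "\<And>g x y. g \<in> carrier \<Gamma> \<Longrightarrow> \<kappa> (\<phi> g x) (\<phi> g y) = \<kappa> x y"
  shows "regular_kernel M \<kappa>"
proof -
  interpret prob_space M by (rule M)
  interpret MM: pair_sigma_finite M M ..
  have sect: "\<kappa> x \<in> borel_measurable M" for x
  proof -
    have "Pair x \<in> M \<rightarrow>\<^sub>M M \<Otimes>\<^sub>M M"
      by (rule measurable_Pair1') (simp add: M(2))
    from measurable_compose[OF this meas] show ?thesis by simp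
  qed
  have law: "distr M borel (\<kappa> x) = distr M borel (\<kappa> y)" for x y
  proof -
    \<comment> \<open>By transitivity some \<open>g\<close> moves \<open>x\<close> to
      \<open>y\<close>; invariance of the measure and of the kernel then carries one section's law
      to the other.\<close>
    obtain g where g: "g \<in> carrier \<Gamma>" "\<phi> g x = y"
      using transitive_action.unique_orbit[OF trans, of x y] by auto
    have "distr M borel (\<kappa> y) = distr (distr M M (\<phi> g)) borel (\<kappa> y)"
      using g \<phi>(2) by simp
    also have "\<dots> = distr M borel (\<kappa> y \<circ> \<phi> g)"
      by (rule distr_distr[OF sect \<phi>(1)[OF g(1)]])
    also have "\<kappa> y \<circ> \<phi> g = \<kappa> x"
      using inv[OF g(1)] g(2) by (auto simp: fun_eq_iff)
    finally show ?thesis by simp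
  qed
  \<comment> \<open>Fubini gives square integrability for almost every section. It depends only on
    the common law, so one good section suffices for all.\<close>
  have "AE x in M. integrable M (\<lambda>y. (\<kappa> x y)\<^sup>2)"
    using MM.AE_integrable_fst'[OF sq] by simp
  moreover have iff: "integrable M (\<lambda>y. (\<kappa> x y)\<^sup>2) \<longleftrightarrow> integrable (distr M borel (\<kappa> undefined)) (\<lambda>t. t\<^sup>2)" for x
    using integrable_distr_eq[OF sect[of x], of "\<lambda>t. t\<^sup>2"] law[of x undefined] by simp
  ultimately have "integrable M (\<lambda>y. (\<kappa> x y)\<^sup>2)" for x
    by simp
  with law sect show ?thesis
    by unfold_locales (use M nonneg sym meas in auto)
qed

lemma essinf_const:
  assumes "prob_space M"
  shows "essinf M (\<lambda>_. c) = c"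
proof -
  interpret prob_space M by (rule assms)
  have "(AE x in M. z \<le> c) \<longleftrightarrow> z \<le> c" for z
    by simp
  then show ?thesis
    by (subst essinf_eq_AE) (simp_all add: atMost_def[symmetric])
qed

theorem corollary2:
  fixes M :: "'a :: {metric_space, second_countable_topology} measure"
    and \<kappa> :: "'a \<Rightarrow> 'a \<Rightarrow> real"
    and \<Gamma> :: "('g, 'm) monoid_scheme"
    and \<phi> :: "'g \<Rightarrow> 'a \<Rightarrow> 'a"
  assumes "prob_space M"
    and "sets M = sets borel"
    and "\<And>x y. 0 \<le> \<kappa> x y"
    and "\<And>x y. \<kappa> x y = \<kappa> y x"
    and "(\<lambda>(x, y). \<kappa> x y) \<in> borel_measurable (M \<Otimes>\<^sub>M M)"
    and "integrable (M \<Otimes>\<^sub>M M) (\<lambda>(x, y). (\<kappa> x y)\<^sup>2)"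
    and "transitive_action \<Gamma> UNIV \<phi>"
    and "\<And>g. g \<in> carrier \<Gamma> \<Longrightarrow> \<phi> g \<in> M \<rightarrow>\<^sub>M M"
    and "\<And>g. g \<in> carrier \<Gamma> \<Longrightarrow> distr M M (\<phi> g) = M"
    and "\<And>g x y. g \<in> carrier \<Gamma> \<Longrightarrow> \<kappa> (\<phi> g x) (\<phi> g y) = \<kappa> x y"
    and "\<not> reducible_kernel M \<kappa>"
    and "AE z in M \<Otimes>\<^sub>M M. isCont (\<lambda>(x, y). \<kappa> x y) z"
  shows "(essinf M (kernel_degree M \<kappa>) < 1 \<longrightarrow>
           (\<lambda>n. \<P>(G in random_graph M \<kappa> n. Digraph_Component.connected (with_proj G))) \<longlonglongrightarrow> 0) \<and>
         (essinf M (kernel_degree M \<kappa>) > 1 \<longrightarrow>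
           (\<lambda>n. \<P>(G in random_graph M \<kappa> n. Digraph_Component.connected (with_proj G))) \<longlonglongrightarrow> 1)"
proof -
  have "space M = UNIV"
    using sets_eq_imp_space_eq[OF assms(2)] by simp
  then interpret regular_kernel M \<kappa>
    by (rule regular_kernel_homogeneous[where \<Gamma>=\<Gamma> and \<phi>=\<phi>, OF assms(1) _ assms(3-10)])
  \<comment> \<open>Lambda is constant, so its essential infimum is its value.\<close>
  have "kernel_degree M \<kappa> = (\<lambda>_. ennreal deg)"
    using nn_integral_eq_integral[OF kernel_integrable] kernel_nonneg
    by (auto simp: kernel_degree_def integral_kernel)
  then have ess: "essinf M (kernel_degree M \<kappa>) = ennreal deg"
    by (simp add: essinf_const prob_space_axioms)
  show ?thesis
    unfolding ess
  proof (intro conjI impI)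
    assume "ennreal deg < 1"
    then have "deg < 1"
      using deg_nonneg by (simp add: ennreal_less_one_iff)
    then show "(\<lambda>n. \<P>(G in \<G> n. conn G)) \<longlonglongrightarrow> 0"
      using tendsto_prob_connected_0 by simp
  next
    assume "1 < ennreal deg"
    then have "1 < deg"
      using deg_nonneg by (metis ennreal_1 ennreal_less_iff zero_le_one)
    \<comment> \<open>Every set of graphs is measurable, so the complement formula applies.\<close>
    have "\<P>(G in \<G> n. conn G) = 1 - measure (\<G> n) {G. \<not> conn G}" for n
    proof -
      interpret R: prob_space "\<G> n" by (rule prob_space_kernel_graph)
      show ?thesis
        using R.prob_compl[of "{G. \<not> conn G}"] by (simp add: Compl_eq_Diff_UNIV[symmetric] Collect_neg_eq[symmetric])
    qed
    then show "(\<lambda>n. \<P>(G in \<G> n. conn G)) \<longlonglongrightarrow> 1"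
      using tendsto_diff[OF tendsto_const tendsto_prob_disconnected_0[OF \<open>1 < deg\<close> assms(11)], of 1] by simp
  qed
qed

end
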